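(* Let $J$ be an infinite set and let $\varphi\in\mathcal S_{\mathbb P_J}(\mathrm{CAR}(J))$ be a symmetric state. Then the following assertions hold. (i) The state $\varphi$ is even, i.e. $\varphi\circ\Theta=\varphi$. (ii) The state $\varphi$ is asymptotically Abelian in average: $$M\{\varphi(C[\alpha_g(A),B]D)\}=0\,,\qquad A,B,C,D\in\mathrm{CAR}(J).$$ (iii) $\varphi$ is an extreme point of $\mathcal S_{\mathbb P_J}(\mathrm{CAR}(J))$ if and only if it is weakly clustering: $$M\{\varphi(\alpha_g(A)B)\}=\varphi(A)\varphi(B)\,,\qquad A,B\in\mathrm{CAR}(J).$$
   Context: $\mathrm{CAR}(J)$ is the unital $C^*$-algebra generated by $\{a_j,a_j^\dagger : j\in J\}$ with $(a_j)^*=a_j^\dagger$, $\{a_j^\dagger,a_k\}=\delta_{jk}1$, $\{a_j,a_k\}=\{a_j^\dagger,a_k^\dagger\}=0$, where $\{a,b\}=ab+ba$; also $[a,b]=ab-ba$. The parity automorphism $\Theta$ is determined by $\Theta(a_j)=-a_j$, $j\in J$. $\mathbb P_J$ is the group of permutations of $J$ moving only finitely many elements; for $I\subset J$ finite, $\mathbb P_I\subset\mathbb P_J$ is the subgroup of the permutations of $I$ (fixing $J\setminus I$). $\mathbb P_J$ acts on $\mathrm{CAR}(J)$ by the automorphisms $\alpha_g$ determined by $\alpha_g(a_j)=a_{gj}$. A state $\varphi$ is symmetric if $\varphi\circ\alpha_g=\varphi$ for all $g\in\mathbb P_J$; $\mathcal S_{\mathbb P_J}(\mathrm{CAR}(J))$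 is the ($*$-weakly compact, convex) set of symmetric states. For a function $f$ on $\mathbb P_J$, the Cesaro mean is $$M\{f(g)\}:=\lim_{I\uparrow J}\frac1{|\mathbb P_I|}\sum_{g\in\mathbb P_I}f(g),$$ the limit being along the net of finite subsets $I\subset J$ directed by inclusion; a statement $M\{f(g)\}=c$ includes the existence of the limit. *)

theory Defs
  imports "HOL-Analysis.Analysis" "HOL-Combinatorics.Permutations"
begin

section \<open>Unital C*-algebras\<close>

text \<open>
  The real structure inherited from the library classes is the restriction of the complex one
  (axiom \<open>scaleR_scaleC\<close>). The class \<^class>\<open>real_normed_algebra_1\<close> includes
  \<open>norm 1 = 1\<close>, so the zero algebra is excluded.
\<close>

class cstar_algebra = real_normed_algebra_1 + banach +
  fixes scaleC :: "complex \<Rightarrow> 'a \<Rightarrow> 'a"  (infixr \<open>*\<^sub>C\<close> 75)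
    and adj :: "'a \<Rightarrow> 'a"
  assumes scaleC_add_right: "c *\<^sub>C (x + y) = c *\<^sub>C x + c *\<^sub>C y"
    and scaleC_add_left: "(c + d) *\<^sub>C x = c *\<^sub>C x + d *\<^sub>C x"
    and scaleC_scaleC: "c *\<^sub>C d *\<^sub>C x = (c * d) *\<^sub>C x"
    and scaleR_scaleC: "r *\<^sub>R x = complex_of_real r *\<^sub>C x"
    and norm_scaleC: "norm (c *\<^sub>C x) = cmod c * norm x"
    and mult_scaleC_left: "(c *\<^sub>C x) * y = c *\<^sub>C (x * y)"
    and mult_scaleC_right: "x * (c *\<^sub>C y) = c *\<^sub>C (x * y)"
    and adj_add: "adj (x + y) = adj x + adj y"
    and adj_scaleC: "adj (c *\<^sub>C x) = cnj c *\<^sub>C adj x"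
    and adj_mult: "adj (x * y) = adj y * adj x"
    and adj_adj: "adj (adj x) = x"
    and cstar_identity: "norm (adj x * x) = (norm x)\<^sup>2"

definition commutator :: "'a::ring \<Rightarrow> 'a \<Rightarrow> 'a" where
  "commutator x y = x * y - y * x"

definition anticommutator :: "'a::ring \<Rightarrow> 'a \<Rightarrow> 'a" where
  "anticommutator x y = x * y + y * x"

definition unital_star_subalgebra :: "'a::cstar_algebra set \<Rightarrow> bool" where
  "unital_star_subalgebra B \<longleftrightarrow>
     1 \<in> B \<and> (\<forall>x\<in>B. \<forall>y\<in>B. x + y \<in> B \<and> x * y \<in> B) \<and>
     (\<forall>c. \<forall>x\<in>B. c *\<^sub>C x \<in> B) \<and> (\<forall>x\<in>B. adj x \<in> B)"

definition generated_cstar :: "'a::cstar_algebra set \<Rightarrow> 'a set" where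
  "generated_cstar S = (\<lambda>B. unital_star_subalgebra B \<and> closed B) hull S"

definition star_automorphism :: "('a::cstar_algebra \<Rightarrow> 'a) \<Rightarrow> bool" where
  "star_automorphism f \<longleftrightarrow>
     bij f \<and> (\<forall>x y. f (x + y) = f x + f y) \<and> (\<forall>c x. f (c *\<^sub>C x) = c *\<^sub>C f x) \<and>
     (\<forall>x y. f (x * y) = f x * f y) \<and> (\<forall>x. f (adj x) = adj (f x))"

text \<open>
  A functional on a complex algebra that is bounded and real-linear is complex-linear once it
  commutes with \<open>scaleC\<close>. Taking states inside the normed space of bounded functionals loses
  nothing, because positive functionals on a C*-algebra are automatically bounded.
\<close>

definition state :: "('a::cstar_algebra \<Rightarrow>\<^sub>L complex) \<Rightarrow> bool" where
  "state \<phi> \<longleftrightarrow>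
     (\<forall>c x. \<phi> (c *\<^sub>C x) = c * \<phi> x) \<and> (\<forall>x. \<phi> (adj x * x) \<in> \<real>\<^sub>\<ge>\<^sub>0) \<and> \<phi> 1 = 1"


section \<open>The CAR algebra\<close>

text \<open>
  The predicate \<open>car_algebra J a\<close> says that the type \<open>'a\<close> is CAR(J) with annihilators
  \<open>a j\<close> for \<open>j \<in> J\<close>; values of \<open>a\<close> outside \<open>J\<close> are irrelevant. Any two nonzero
  C*-algebras generated by families satisfying the relations are isomorphic through an
  isomorphism matching the generators.
\<close>

definition car_algebra :: "'j set \<Rightarrow> ('j \<Rightarrow> 'a::cstar_algebra) \<Rightarrow> bool" where
  "car_algebra J a \<longleftrightarrow>
     (\<forall>j\<in>J. \<forall>k\<in>J.
        anticommutator (adj (a j)) (a k) = (if j = k then 1 else 0) \<and>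
        anticommutator (a j) (a k) = 0 \<and>
        anticommutator (adj (a j)) (adj (a k)) = 0) \<and>
     generated_cstar (a ` J) = UNIV"

text \<open>
  The following two automorphisms exist and are unique in every CAR algebra: they are determined
  by their values on the generators, since *-automorphisms are isometric.
\<close>

definition parity :: "'j set \<Rightarrow> ('j \<Rightarrow> 'a::cstar_algebra) \<Rightarrow> 'a \<Rightarrow> 'a" where
  "parity J a = (THE f. star_automorphism f \<and> (\<forall>j\<in>J. f (a j) = - a j))"

definition perm_aut :: "'j set \<Rightarrow> ('j \<Rightarrow> 'a::cstar_algebra) \<Rightarrow> ('j \<Rightarrow> 'j) \<Rightarrow> 'a \<Rightarrow> 'a" where
  "perm_aut J a g = (THE f. star_automorphism f \<and> (\<forall>j\<in>J. f (a j) = a (g j)))"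

definition finite_perms :: "'j set \<Rightarrow> ('j \<Rightarrow> 'j) set" where
  "finite_perms J = {g. \<exists>I. finite I \<and> I \<subseteq> J \<and> g permutes I}"

definition symmetric_states ::
    "'j set \<Rightarrow> ('j \<Rightarrow> 'a::cstar_algebra) \<Rightarrow> ('a \<Rightarrow>\<^sub>L complex) set" where
  "symmetric_states J a =
     {\<phi>. state \<phi> \<and>
         (\<forall>g\<in>finite_perms J. blinfun_apply \<phi> \<circ> perm_aut J a g = blinfun_apply \<phi>)}"

text \<open>The limit exists and equals \<open>c\<close>; only the values of \<open>f\<close> on \<open>finite_perms J\<close> matter.\<close>

definition has_cesaro_mean :: "'j set \<Rightarrow> (('j \<Rightarrow> 'j) \<Rightarrow> complex) \<Rightarrow> complex \<Rightarrow> bool" where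
  "has_cesaro_mean J f c \<longleftrightarrow>
     ((\<lambda>I. (\<Sum>g | g permutes I. f g) / of_nat (card {g. g permutes I})) \<longlongrightarrow> c)
       (finite_subsets_at_top J)"

definition asymptotically_abelian_in_average ::
    "'j set \<Rightarrow> ('j \<Rightarrow> 'a::cstar_algebra) \<Rightarrow> ('a \<Rightarrow>\<^sub>L complex) \<Rightarrow> bool" where
  "asymptotically_abelian_in_average J a \<phi> \<longleftrightarrow>
     (\<forall>A B C D. has_cesaro_mean J (\<lambda>g. \<phi> (C * commutator (perm_aut J a g A) B * D)) 0)"

definition weakly_clustering ::
    "'j set \<Rightarrow> ('j \<Rightarrow> 'a::cstar_algebra) \<Rightarrow> ('a \<Rightarrow>\<^sub>L complex) \<Rightarrow> bool" where
  "weakly_clustering J a \<phi> \<longleftrightarrow>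
     (\<forall>A B. has_cesaro_mean J (\<lambda>g. \<phi> (perm_aut J a g A * B)) (\<phi> A * \<phi> B))"

end

theory Submission
  imports Defs
begin

text \<open>
  Let \<open>S\<^sub>I\<close> denote averaging over the permutations of a finite set \<open>I\<close> of modes. Apart from a
  proportion of order \<open>1/|I|\<close>, a permutation moves a fixed finite set of modes off another one, and
  elements with disjoint sets of modes commute or anticommute according to parity. Hence
  \<open>[S\<^sub>I A, B] \<longrightarrow> 0\<close> in norm for even \<open>A\<close>. For odd self-adjoint \<open>A\<close>, \<open>2 (S\<^sub>I A)\<^sup>2\<close> is the average of
  the anticommutators of \<open>A\<close> and its translates, so \<open>S\<^sub>I A \<longrightarrow> 0\<close> in norm. Thus symmetric states vanish
  on odd elements, and every bounded functional is asymptotically Abelian in average.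

  If \<open>\<phi>\<close> is weakly clustering, \<open>S\<^sub>I A\<close> converges to the constant \<open>\<phi> A\<close> in the \<open>\<phi>\<close>-seminorm, hence also
  in the seminorm of any symmetric state dominated by a multiple of \<open>\<phi>\<close>, which therefore equals \<open>\<phi>\<close>.
  Conversely, for \<open>0 \<le> A \<le> 1\<close> the limit \<open>\<psi> B = lim \<phi> (S\<^sub>I A B)\<close> exists because
  \<open>\<phi> (A S\<^sub>I A)\<close> is decreasing in \<open>I\<close>; it is symmetric and satisfies \<open>0 \<le> \<psi> \<le> \<phi>\<close>, so extremality
  forces \<open>\<psi> = \<phi> A \<cdot> \<phi>\<close>.
\<close>

section \<open>Elementary C*-algebra\<close>

text \<open>The C*-identity and submultiplicativity give \<open>norm y \<le> norm (adj y)\<close>;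
  applying the involution gives the other inequality.\<close>

lemma norm_adj [simp]: "norm (adj x) = norm (x::'a::cstar_algebra)"
proof -
  have le: "norm y \<le> norm (adj y)" for y :: 'a
  proof (cases "norm y = 0")
    case False
    have "norm y * norm y \<le> norm (adj y) * norm y"
      using norm_mult_ineq[of "adj y" y] cstar_identity[of y] by (simp add: power2_eq_square)
    with False show ?thesis by simp
  qed simp
  show ?thesis using le[of x] le[of "adj x"] by (simp add: adj_adj)
qed

lemma scaleC_one [simp]: "1 *\<^sub>C x = (x::'a::cstar_algebra)"
  using scaleR_scaleC[of 1 x] by simp

lemma adj_scaleR: "adj (r *\<^sub>R x) = r *\<^sub>R adj (x::'a::cstar_algebra)"
  by (simp add: scaleR_scaleC adj_scaleC)

lemma bounded_linear_adj: "bounded_linear (adj :: 'a::cstar_algebra \<Rightarrow> 'a)"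
  by (rule bounded_linear_intro[where K = 1]) (simp_all add: adj_add adj_scaleR)

lemma bounded_linear_scaleC: "bounded_linear (\<lambda>x::'a::cstar_algebra. c *\<^sub>C x)"
proof (rule bounded_linear_intro[where K = "cmod c"])
  show "c *\<^sub>C (r *\<^sub>R x) = r *\<^sub>R (c *\<^sub>C x)" for r and x :: 'a
    by (simp add: scaleR_scaleC scaleC_scaleC mult.commute)
qed (simp_all add: scaleC_add_right norm_scaleC mult.commute)

lemmas adj_zero = linear_0[OF bounded_linear.linear[OF bounded_linear_adj]]
lemmas adj_minus = linear_neg[OF bounded_linear.linear[OF bounded_linear_adj]]
lemmas adj_diff = linear_diff[OF bounded_linear.linear[OF bounded_linear_adj]]
lemmas scaleC_zero_right = linear_0[OF bounded_linear.linear[OF bounded_linear_scaleC]]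
lemmas scaleC_minus_right = linear_neg[OF bounded_linear.linear[OF bounded_linear_scaleC]]
lemmas scaleC_diff_right = linear_diff[OF bounded_linear.linear[OF bounded_linear_scaleC]]
lemmas tendsto_adj = bounded_linear.tendsto[OF bounded_linear_adj]
lemmas tendsto_scaleC = bounded_linear.tendsto[OF bounded_linear_scaleC]

lemma adj_one [simp]: "adj 1 = (1::'a::cstar_algebra)"
proof -
  have "adj (adj 1 * 1) = (adj 1 * 1 :: 'a)"
    by (simp only: adj_mult adj_adj)
  then show ?thesis by (simp add: adj_adj)
qed

lemma adj_power: "adj (x ^ n) = adj (x::'a::cstar_algebra) ^ n"
  by (induction n) (simp_all add: adj_mult power_commutes)

lemma scaleC_zero_left [simp]: "0 *\<^sub>C x = (0::'a::cstar_algebra)"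
  using scaleR_scaleC[of 0 x] by simp

lemma scaleC_minus_left: "(- c) *\<^sub>C x = - (c *\<^sub>C (x::'a::cstar_algebra))"
  using scaleC_add_left[of "- c" c x] by (simp add: eq_neg_iff_add_eq_0)

lemma scaleC_minus_one: "(-1) *\<^sub>C x = - (x::'a::cstar_algebra)"
  by (simp add: scaleC_minus_left)

lemma norm_unitary: "norm w = 1" if "adj w * w = (1::'a::cstar_algebra)"
proof -
  have "(norm w)\<^sup>2 = 1\<^sup>2" using cstar_identity[of w] that by simp
  then show ?thesis by (rule power2_eq_imp_eq) auto
qed

text \<open>The formulas for \<open>h\<close> and \<open>k\<close> are exported so that both can
  later be shown to inherit locality and oddness from \<open>x\<close>.\<close>

lemma selfadj_decomposition:
  fixes x :: "'a::cstar_algebra"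
  obtains h k where "adj h = h" "adj k = k" "x = h + \<i> *\<^sub>C k"
    "h = (1/2) *\<^sub>C (x + adj x)" "k = (- \<i> / 2) *\<^sub>C (x - adj x)"
proof
  have eq: "\<i> *\<^sub>C ((- \<i> / 2) *\<^sub>C (x - adj x)) = (1/2) *\<^sub>C (x - adj x)"
    by (simp add: scaleC_scaleC)
  have "(1/2) *\<^sub>C (x + adj x) + (1/2) *\<^sub>C (x - adj x) = (1/2) *\<^sub>C (x + x)"
    by (simp add: scaleC_add_right[symmetric])
  also have "\<dots> = x"
    by (simp add: scaleC_add_right scaleC_add_left[symmetric])
  finally show "x = (1/2) *\<^sub>C (x + adj x) + \<i> *\<^sub>C ((- \<i> / 2) *\<^sub>C (x - adj x))"
    by (simp only: eq)
  have "adj ((- \<i> / 2) *\<^sub>C (x - adj x)) = (\<i> / 2) *\<^sub>C (- (x - adj x))"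
    by (simp add: adj_scaleC adj_diff adj_adj)
  also have "\<dots> = (- \<i> / 2) *\<^sub>C (x - adj x)"
    unfolding scaleC_minus_one[symmetric] by (simp add: scaleC_scaleC)
  finally show "adj ((- \<i> / 2) *\<^sub>C (x - adj x)) = (- \<i> / 2) *\<^sub>C (x - adj x)" .
  show "adj ((1/2) *\<^sub>C (x + adj x)) = (1/2) *\<^sub>C (x + adj x)"
    by (simp add: adj_scaleC adj_add adj_adj add.commute[of x])
qed (rule refl)+

section \<open>Square roots near the identity\<close>

text \<open>This crude bound is enough to compare the binomial series with a geometric one. It
  survives the recursion because |1/2 - n| \<le> n + 1.\<close>

lemma abs_gbinomial_half_le_1: "\<bar>(1/2 :: real) gchoose n\<bar> \<le> 1"
proof (induction n)
  case (Suc n)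
  have "(real n + 1) * ((1/2) gchoose Suc n) = (1/2 - real n) * ((1/2) gchoose n)"
    using gbinomial_mult_1[of "1/2::real" n] by (simp add: algebra_simps)
  then have "(real n + 1) * \<bar>(1/2 :: real) gchoose Suc n\<bar> = \<bar>1/2 - real n\<bar> * \<bar>(1/2) gchoose n\<bar>"
    by (metis abs_mult abs_of_nonneg add_nonneg_nonneg of_nat_0_le_iff zero_le_one)
  also have "\<dots> \<le> (real n + 1) * 1"
    using Suc by (intro mult_mono) auto
  finally show ?case by (simp del: gbinomial_Suc_Suc)
qed simp

text \<open>The root is given by the binomial series, so it commutes with whatever commutes with \<open>x\<close>.\<close>

lemma sqrt_one_minus:
  fixes x :: "'a::cstar_algebra"
  assumes "norm x < 1" "adj x = x"
  obtains y where "adj y = y" "y * y = 1 - x" "\<And>z. z * x = x * z \<Longrightarrow> z * y = y * z"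
proof -
  define c where "c n = (-1)^n * ((1/2 :: real) gchoose n)" for n
  define t where "t n = c n *\<^sub>R x ^ n" for n
  have "norm (t n) \<le> norm x ^ n" for n
  proof -
    have "norm (t n) = \<bar>(1/2 :: real) gchoose n\<bar> * norm (x ^ n)"
      by (simp add: t_def c_def abs_mult)
    also have "\<dots> \<le> 1 * norm x ^ n"
      by (intro mult_mono abs_gbinomial_half_le_1 norm_power_ineq) auto
    finally show ?thesis by simp
  qed
  then have sm: "summable (\<lambda>n. norm (t n))"
    using assms(1) by (intro summable_comparison_test[OF _ summable_geometric[of "norm x"]]) auto
  then have smt: "summable t" by (rule summable_norm_cancel)
  define y where "y = (\<Sum>n. t n)"
  have ty: "t sums y" using smt by (simp add: y_def summable_sums)
  \<comment> \<open>By Vandermonde the Cauchy square has the coefficients of the exponent 1/2 + 1/2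
    = 1, of which only those of order 0 and 1 are nonzero.\<close>
  have conv: "(\<Sum>i\<le>n. t i * t (n - i)) = (if n = 0 then 1 else if n = 1 then - x else 0)" for n
  proof -
    have "(\<Sum>i\<le>n. t i * t (n - i)) = (\<Sum>i\<le>n. (c i * c (n - i)) *\<^sub>R x ^ n)"
      by (intro sum.cong) (auto simp: t_def power_add[symmetric])
    also have "\<dots> = (\<Sum>i\<le>n. c i * c (n - i)) *\<^sub>R x ^ n"
      by (simp add: scaleR_sum_left)
    also have "(\<Sum>i\<le>n. c i * c (n - i))
        = (\<Sum>i\<le>n. (-1)^n * (((1/2) gchoose i) * ((1/2) gchoose (n - i))))"
      by (intro sum.cong) (auto simp: c_def power_add[symmetric])
    also have "\<dots> = (-1)^n * ((1/2 + 1/2) gchoose n)"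
      by (subst gbinomial_Vandermonde[symmetric]) (simp add: sum_distrib_left atMost_atLeast0)
    also have "(1/2 + 1/2 :: real) gchoose n = of_nat (1 choose n)"
      by (simp add: binomial_gbinomial)
    finally show ?thesis by (cases n; cases "n - 1") (auto simp: binomial_eq_0)
  qed
  have "(\<lambda>n. \<Sum>i\<le>n. t i * t (n - i)) sums (y * y)"
    unfolding y_def by (rule Cauchy_product_sums[OF sm sm])
  moreover have "(\<lambda>n. if n = 0 then 1 else if n = 1 then - x else 0) sums
      (\<Sum>n\<in>{0,1::nat}. if n = 0 then 1 else if n = 1 then - x else 0)"
    by (rule sums_finite) auto
  ultimately have "y * y = 1 - x"
    using sums_unique2 unfolding conv by fastforce
  moreover have "adj y = y"
  proof -
    have "(\<lambda>n. adj (t n)) sums adj y"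
      by (rule bounded_linear.sums[OF bounded_linear_adj ty])
    moreover have "adj (t n) = t n" for n
      by (simp add: t_def adj_scaleR adj_power assms(2))
    ultimately show ?thesis
      using ty by (simp add: sums_unique2)
  qed
  moreover have "z * y = y * z" if z: "z * x = x * z" for z
  proof -
    have "z * x ^ n = x ^ n * z" for n
      by (metis power_commuting_commutes z)
    then have "z * t n = t n * z" for n
      by (simp add: t_def)
    then show ?thesis
      using sums_mult[OF ty, of z] sums_mult2[OF ty, of z] by (simp add: sums_unique2)
  qed
  ultimately show ?thesis using that by blast
qed

text \<open>States are positive on elements of the form \<open>adj y * y\<close>; rescaling the
  binomial root puts the elements needed later into that form.\<close>

lemma positive_scaled_one_minus:
  fixes x :: "'a::cstar_algebra"
  assumes "norm x < r" "adj x = x"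
  obtains y where "adj y * y = r *\<^sub>R 1 - x"
proof -
  have r: "r > 0" using assms(1) norm_ge_zero[of x] by linarith
  obtain y where y: "adj y = y" "y * y = 1 - (1 / r) *\<^sub>R x"
  proof (rule sqrt_one_minus)
    show "norm ((1 / r) *\<^sub>R x) < 1" "adj ((1 / r) *\<^sub>R x) = (1 / r) *\<^sub>R x"
      using assms r by (simp_all add: adj_scaleR)
  qed blast
  have "adj (sqrt r *\<^sub>R y) * (sqrt r *\<^sub>R y) = r *\<^sub>R (y * y)"
    using r by (simp add: adj_scaleR y(1) real_sqrt_mult_self)
  also have "\<dots> = r *\<^sub>R 1 - x"
    using r by (simp add: y(2) scaleR_diff_right)
  finally show ?thesis by (rule that)
qed

section \<open>Unital *-homomorphisms and their contractivity\<close>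

text \<open>Unitality is a separate clause since without surjectivity it does not follow from the
  others; continuity is a consequence.\<close>

definition star_hom :: "('a::cstar_algebra \<Rightarrow> 'b::cstar_algebra) \<Rightarrow> bool" where
  "star_hom f \<longleftrightarrow> f 1 = 1 \<and> (\<forall>x y. f (x + y) = f x + f y) \<and> (\<forall>c x. f (c *\<^sub>C x) = c *\<^sub>C f x) \<and>
     (\<forall>x y. f (x * y) = f x * f y) \<and> (\<forall>x. f (adj x) = adj (f x))"

lemma
  assumes "star_hom f"
  shows star_hom_one: "f 1 = 1" and star_hom_add: "f (x + y) = f x + f y"
    and star_hom_scaleC: "f (c *\<^sub>C x) = c *\<^sub>C f x" and star_hom_mult: "f (x * y) = f x * f y"
    and star_hom_adj: "f (adj x) = adj (f x)"
  using assms by (auto simp: star_hom_def)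

lemma star_automorphism_iff: "star_automorphism f \<longleftrightarrow> bij f \<and> star_hom f"
proof -
  have "f 1 = 1" if "surj f" "\<forall>x y. f (x * y) = f x * f y"
  proof -
    obtain u where u: "1 = f u" using surjD[OF \<open>surj f\<close>, of 1] by blast
    have "f (u * 1) = f u * f 1" using that(2) by blast
    then show ?thesis by (simp add: u[symmetric])
  qed
  then have "bij f \<Longrightarrow> \<forall>x y. f (x * y) = f x * f y \<Longrightarrow> f 1 = 1"
    by (blast dest: bij_is_surj)
  then show ?thesis
    unfolding star_automorphism_def star_hom_def by blast
qed

lemma star_hom_comp: "star_hom f \<Longrightarrow> star_hom g \<Longrightarrow> star_hom (f \<circ> g)"
  by (simp add: star_hom_def)

lemma star_hom_scaleR: "star_hom f \<Longrightarrow> f (r *\<^sub>R x) = r *\<^sub>R f x"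
  by (simp add: scaleR_scaleC star_hom_scaleC)

text \<open>If \<open>h\<close> is self-adjoint of norm less than 1, then \<open>h + \<i> sqrt (1 - h\<^sup>2)\<close> is unitary, and
  homomorphisms preserve unitarity.\<close>

lemma star_hom_norm_le:
  fixes x :: "'a::cstar_algebra"
  assumes f: "star_hom f"
  shows "norm (f x) \<le> norm x"
proof -
  have unit: "norm (f h) \<le> 1" if h: "adj h = h" "norm h < 1" for h
  proof -
    have n: "norm (h * h) < 1"
      using cstar_identity[of h] h by (simp add: power_less_one_iff abs_square_less_1)
    obtain y where y: "adj y = y" "y * y = 1 - h * h" "h * y = y * h"
      by (rule sqrt_one_minus[OF n]) (auto simp: adj_mult h mult.assoc)
    define w where "w = h + \<i> *\<^sub>C y"
    have "adj w = h + (- \<i>) *\<^sub>C y"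
      by (simp add: w_def adj_add adj_scaleC h y)
    then have "adj w * w = h * h + y * y + \<i> *\<^sub>C (h * y - y * h)"
      by (simp add: w_def distrib_left distrib_right left_diff_distrib mult_scaleC_left
          mult_scaleC_right scaleC_add_right scaleC_scaleC scaleC_minus_left
          scaleC_diff_right)
    also have "\<dots> = 1"
      using y by (simp add: scaleC_zero_right)
    finally have "adj (f w) * f w = 1"
      using f by (metis star_hom_adj star_hom_mult star_hom_one)
    then have nw: "norm (f w) = 1" by (rule norm_unitary)
    have "w + adj w = 2 *\<^sub>R h"
      by (simp only: \<open>adj w = _\<close>) (simp add: w_def scaleR_2 scaleC_minus_left)
    then have "f w + adj (f w) = 2 *\<^sub>R f h"
      using f by (metis star_hom_add star_hom_adj star_hom_scaleR)
    then have "2 * norm (f h) = norm (f w + adj (f w))" by simp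
    also have "\<dots> \<le> 1 + 1"
      using norm_triangle_ineq[of "f w" "adj (f w)"] nw by simp
    finally show ?thesis by simp
  qed
  \<comment> \<open>All \<open>r\<close> above \<open>norm h\<close> are used for rescaling, because
    \<open>unit\<close> asks for a norm strictly below 1.\<close>
  have sa: "norm (f h) \<le> norm h" if h: "adj h = h" for h
  proof (rule dense_ge)
    fix r assume r: "norm h < r"
    then have r0: "r > 0" using norm_ge_zero[of h] by linarith
    have "norm (f ((1 / r) *\<^sub>R h)) \<le> 1"
      using r r0 by (intro unit) (auto simp: adj_scaleR h divide_simps)
    then show "norm (f h) \<le> r"
      using r0 by (simp add: star_hom_scaleR[OF f] divide_simps split: if_splits)
  qed
  \<comment> \<open>The C*-identity reduces the general case to the self-adjoint element
    \<open>adj x * x\<close>.\<close>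
  have "(norm (f x))\<^sup>2 = norm (f (adj x * x))"
    using f by (simp add: star_hom_mult star_hom_adj cstar_identity)
  also have "\<dots> \<le> norm (adj x * x)"
    by (rule sa) (simp add: adj_mult adj_adj)
  finally show ?thesis
    by (simp add: cstar_identity)
qed

lemma bounded_linear_star_hom: "star_hom f \<Longrightarrow> bounded_linear f"
  by (rule bounded_linear_intro[where K = 1])
    (simp_all add: star_hom_add star_hom_scaleR star_hom_norm_le)

lemma star_automorphism_norm: 
  assumes "star_automorphism f"
  shows "norm (f x) = norm x"
proof (rule antisym)
  from assms have bij: "bij f" and f: "star_hom f" by (auto simp: star_automorphism_iff)
  show "norm (f x) \<le> norm x" by (rule star_hom_norm_le[OF f])
  have inv_eqI: "inv f (f y) = y" for y using bij by (simp add: bij_is_inj)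
  have f_inv: "f (inv f y) = y" for y using bij by (simp add: bij_is_surj surj_f_inv_f)
  have inv_f_eq: "f y = z \<Longrightarrow> inv f z = y" for y z by (metis inv_eqI)
  \<comment> \<open>Contractivity of the inverse is the reverse inequality.\<close>
  have "star_hom (inv f)"
    unfolding star_hom_def
    by (intro conjI allI inv_f_eq)
      (simp_all add: f_inv star_hom_one[OF f] star_hom_add[OF f] star_hom_scaleC[OF f]
        star_hom_mult[OF f] star_hom_adj[OF f])
  from star_hom_norm_le[OF this, of "f x"] show "norm x \<le> norm (f x)"
    by (simp add: inv_eqI)
qed

lemma star_automorphism_comp:
  "star_automorphism f \<Longrightarrow> star_automorphism g \<Longrightarrow> star_automorphism (f \<circ> g)"
  by (auto simp: star_automorphism_iff intro: star_hom_comp bij_comp)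

lemma star_automorphism_id: "star_automorphism (\<lambda>x. x)"
  by (simp add: star_automorphism_iff star_hom_def bij_id[unfolded id_def])

lemma star_automorphism_inner:
  fixes w :: "'a::cstar_algebra"
  assumes "adj w = w" "w * w = 1"
  shows "star_automorphism (\<lambda>x. w * x * w)"
proof -
  have ww: "w * (w * z) = z" for z by (simp add: assms(2) mult.assoc[symmetric])
  have "bij (\<lambda>x. w * x * w)"
    by (rule o_bij[where g = "\<lambda>x. w * x * w"]) (auto simp: fun_eq_iff mult.assoc ww assms(2))
  then show ?thesis
    by (simp add: star_automorphism_def algebra_simps mult_scaleC_left mult_scaleC_right
        adj_mult assms(1) ww)
qed

section \<open>Generated subalgebras\<close>

abbreviation closed_star_subalgebra :: "'a::cstar_algebra set \<Rightarrow> bool" where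
  "closed_star_subalgebra B \<equiv> unital_star_subalgebra B \<and> closed B"

lemma closed_star_subalgebra_generated: "closed_star_subalgebra (generated_cstar S)"
  unfolding generated_cstar_def
  by (rule hull_in) (auto simp: unital_star_subalgebra_def)

lemma generated_cstar_minimal:
  "S \<subseteq> B \<Longrightarrow> closed_star_subalgebra B \<Longrightarrow> generated_cstar S \<subseteq> B"
  unfolding generated_cstar_def by (rule hull_minimal)

lemma generated_cstar_inc: "x \<in> S \<Longrightarrow> x \<in> generated_cstar S"
  unfolding generated_cstar_def by (rule hull_inc)

lemma generated_cstar_mono: "S \<subseteq> T \<Longrightarrow> generated_cstar S \<subseteq> generated_cstar T"
  unfolding generated_cstar_def by (rule hull_mono)

lemma
  assumes "unital_star_subalgebra B"
  shows subalgebra_one: "1 \<in> B" and subalgebra_add: "x \<in> B \<Longrightarrow> y \<in> B \<Longrightarrow> x + y \<in> B"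
    and subalgebra_mult: "x \<in> B \<Longrightarrow> y \<in> B \<Longrightarrow> x * y \<in> B"
    and subalgebra_scaleC: "x \<in> B \<Longrightarrow> c *\<^sub>C x \<in> B" and subalgebra_adj: "x \<in> B \<Longrightarrow> adj x \<in> B"
  using assms by (auto simp: unital_star_subalgebra_def)

lemma subalgebra_minus: "unital_star_subalgebra B \<Longrightarrow> x \<in> B \<Longrightarrow> - x \<in> B"
  using subalgebra_scaleC[of B x "-1"] by (simp add: scaleC_minus_one)

lemma subalgebra_diff: "unital_star_subalgebra B \<Longrightarrow> x \<in> B \<Longrightarrow> y \<in> B \<Longrightarrow> x - y \<in> B"
  using subalgebra_add[of B x "- y"] subalgebra_minus[of B y] by simp

lemma closed_star_subalgebra_vimage:
  assumes "star_hom f" "closed_star_subalgebra B"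
  shows "closed_star_subalgebra (f -` B)"
proof
  show "unital_star_subalgebra (f -` B)"
    using assms by (simp add: star_hom_def unital_star_subalgebra_def)
  have "continuous_on UNIV f"
    by (rule linear_continuous_on[OF bounded_linear_star_hom[OF assms(1)]])
  then show "closed (f -` B)"
    using assms(2) by (simp add: closed_vimage continuous_on_eq_continuous_at)
qed

text \<open>The set where two homomorphisms agree is a *-subalgebra, and it is closed because both
  are continuous.\<close>

lemma star_hom_generated_eq:
  assumes f: "star_hom f" and g: "star_hom g"
    and eq: "\<And>x. x \<in> S \<Longrightarrow> f x = g x" and x: "x \<in> generated_cstar S"
  shows "f x = g x"
proof -
  note cont = linear_continuous_on[OF bounded_linear_star_hom]
  have "closed_star_subalgebra {x. f x = g x}"
  proof
    show "unital_star_subalgebra {x. f x = g x}"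
      using f g by (simp add: star_hom_def unital_star_subalgebra_def)
    show "closed {x. f x = g x}"
      by (intro closed_Collect_eq cont f g)
  qed
  from generated_cstar_minimal[OF _ this, of S] eq x show ?thesis by blast
qed

lemma closure_unital_star_subalgebra:
  assumes "unital_star_subalgebra B"
  shows "closed_star_subalgebra (closure B)"
proof
  show "unital_star_subalgebra (closure B)"
    unfolding unital_star_subalgebra_def
  proof (intro conjI ballI allI)
    show "1 \<in> closure B"
      using subalgebra_one[OF assms] closure_subset by blast
    fix x assume "x \<in> closure B"
    then obtain u where u: "\<And>n. u n \<in> B" "u \<longlonglongrightarrow> x"
      unfolding closure_sequential by blast
    show "c *\<^sub>C x \<in> closure B" for c
      using u assms unfolding closure_sequential
      by (intro exI[of _ "\<lambda>n. c *\<^sub>C u n"]) (auto intro: subalgebra_scaleC tendsto_scaleC)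
    show "adj x \<in> closure B"
      using u assms unfolding closure_sequential
      by (intro exI[of _ "\<lambda>n. adj (u n)"]) (auto intro: subalgebra_adj tendsto_adj)
    fix y assume "y \<in> closure B"
    then obtain v where v: "\<And>n. v n \<in> B" "v \<longlonglongrightarrow> y"
      unfolding closure_sequential by blast
    show "x + y \<in> closure B"
      using u v assms unfolding closure_sequential
      by (intro exI[of _ "\<lambda>n. u n + v n"]) (auto intro: subalgebra_add tendsto_add)
    show "x * y \<in> closure B"
      using u v assms unfolding closure_sequential
      by (intro exI[of _ "\<lambda>n. u n * v n"]) (auto intro: subalgebra_mult tendsto_mult)
  qed
qed simp

section \<open>Permutation and parity automorphisms\<close>

text \<open>If \<open>d/\<surd>2\<close> is a fermionic mode then \<open>1 - d\<^sup>* d\<close> is a self-adjoint unitary, and conjugation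
  with it reverses the sign of this mode only.\<close>

lemma mode_reflection:
  fixes d :: "'a::cstar_algebra"
  assumes dd: "d * d = 0" and ac: "adj d * d + d * adj d = 1 + 1"
  shows "\<exists>f. star_automorphism f \<and> f d = - d \<and>
    (\<forall>c. d * c = - (c * d) \<longrightarrow> adj d * c = - (c * adj d) \<longrightarrow> f c = c)"
proof -
  define e where "e = adj d"
  define w where "w = 1 - e * d"
  have de: "d * e = 1 + 1 - e * d"
    using ac unfolding e_def by (simp add: algebra_simps)
  have ded: "d * (e * d) = d + d"
  proof -
    have "d * (e * d) = (d * e) * d" by (simp only: mult.assoc)
    also have "\<dots> = d + d - e * (d * d)" by (simp only: de left_diff_distrib distrib_right mult_1 mult.assoc)
    finally show ?thesis by (simp add: dd)
  qed
  have wd: "w * d = d"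
    by (simp add: w_def left_diff_distrib mult.assoc dd)
  have dw: "d * w = - d"
    by (simp add: w_def right_diff_distrib ded)
  have ww: "w * w = 1"
  proof -
    have "w * w = w - e * (d * w)"
      by (simp add: w_def left_diff_distrib mult.assoc)
    then show ?thesis by (simp add: dw) (simp add: w_def)
  qed
  have "adj w = w"
    by (simp add: w_def e_def adj_diff adj_mult adj_adj)
  then have aut: "star_automorphism (\<lambda>x. w * x * w)"
    by (rule star_automorphism_inner[OF _ ww])
  \<comment> \<open>Moving \<open>c\<close> past \<open>e * d\<close> changes the sign twice, so
    \<open>c\<close> commutes with \<open>w\<close>.\<close>
  have fixed: "w * c * w = c" if "d * c = - (c * d)" "e * c = - (c * e)" for c
  proof -
    have "e * d * c = e * (d * c)" by (simp only: mult.assoc)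
    also have "\<dots> = - ((e * c) * d)" by (simp add: that(1) mult.assoc)
    also have "\<dots> = c * (e * d)" by (simp add: that(2) mult.assoc)
    finally have "w * c = c * w" by (simp add: w_def left_diff_distrib right_diff_distrib)
    then show ?thesis by (simp add: mult.assoc ww)
  qed
  show ?thesis
    using aut wd dw fixed by (intro exI[of _ "\<lambda>x. w * x * w"]) (simp add: e_def)
qed

section \<open>Existence of permutation and flip automorphisms of the CAR algebra\<close>

locale car_system =
  fixes J :: "'j set" and a :: "'j \<Rightarrow> 'a::cstar_algebra"
  assumes car: "car_algebra J a"
begin

lemma
  assumes "j \<in> J" "k \<in> J"
  shows adj_a_a: "adj (a j) * a k = (if j = k then 1 else 0) - a k * adj (a j)"
    and a_a: "a j * a k = - (a k * a j)"
proof -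
  have "adj (a j) * a k + a k * adj (a j) = (if j = k then 1 else 0)"
    "a j * a k + a k * a j = 0"
    using car assms unfolding car_algebra_def anticommutator_def by blast+
  then show "adj (a j) * a k = (if j = k then 1 else 0) - a k * adj (a j)"
    and "a j * a k = - (a k * a j)"
    by (simp_all only: eq_diff_eq eq_neg_iff_add_eq_0)
qed

lemma a_sq: "j \<in> J \<Longrightarrow> a j * a j = 0"
  using a_a[of j j] by (metis eq_neg_iff_add_eq_0 scaleR_2 scaleR_eq_0_iff zero_neq_numeral)

lemma generated_UNIV: "generated_cstar (a ` J) = UNIV"
  using car by (simp add: car_algebra_def)

lemma star_hom_eqI:
  "star_hom f \<Longrightarrow> star_hom g \<Longrightarrow> (\<And>j. j \<in> J \<Longrightarrow> f (a j) = g (a j)) \<Longrightarrow> f = g"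
  using star_hom_generated_eq[of f g "a ` J"] by (auto simp: generated_UNIV fun_eq_iff)

text \<open>Makes the \<open>THE\<close> in \<open>parity\<close> and \<open>perm_aut\<close>
  meaningful once existence is known.\<close>

lemma star_automorphism_unique:
  assumes "\<exists>f. star_automorphism f \<and> (\<forall>j\<in>J. f (a j) = b j)"
  shows "\<exists>!f. star_automorphism f \<and> (\<forall>j\<in>J. f (a j) = b j)"
  using assms by (auto simp: star_automorphism_iff intro: star_hom_eqI)

text \<open>In the rotated modes \<open>a j + a k\<close> and \<open>a j - a k\<close>, a
  transposition fixes the first and reverses the second, so it is a mode reflection.\<close>

lemma swap_aut:
  assumes jk: "j \<in> J" "k \<in> J" "j \<noteq> k"
  shows "\<exists>f. star_automorphism f \<and> (\<forall>l\<in>J. f (a l) = a (Transposition.transpose j k l))"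
proof -
  define c d where "c = a j + a k" and "d = a j - a k"
  have kj: "a k * a j = - (a j * a k)" using a_a jk by blast
  have dd: "d * d = 0"
    by (simp add: d_def algebra_simps a_sq jk kj)
  have ac: "adj d * d + d * adj d = 1 + 1"
    using jk by (simp add: d_def algebra_simps adj_diff adj_a_a)
  obtain f where f: "star_automorphism f" "f d = - d"
      "\<And>c. d * c = - (c * d) \<Longrightarrow> adj d * c = - (c * adj d) \<Longrightarrow> f c = c"
    using mode_reflection[OF dd ac] by blast
  have hom: "star_hom f" using f(1) by (simp add: star_automorphism_iff)
  have fc: "f c = c"
    using jk by (intro f(3)) (simp_all add: c_def d_def algebra_simps adj_diff adj_a_a a_sq kj)
  have diff: "f (x - y) = f x - f y" for x y
    using star_hom_add[OF hom, of "x - y" y] by simp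
  have "2 *\<^sub>R a j = c + d" "2 *\<^sub>R a k = c - d"
    by (simp_all add: c_def d_def scaleR_2)
  then have "2 *\<^sub>R f (a j) = 2 *\<^sub>R a k" "2 *\<^sub>R f (a k) = 2 *\<^sub>R a j"
    by (metis (no_types) star_hom_scaleR[OF hom] star_hom_add[OF hom] diff fc f(2)
        diff_minus_eq_add uminus_add_conv_diff add.commute)+
  then have "f (a j) = a k" "f (a k) = a j" by simp_all
  moreover have "f (a l) = a l" if "l \<in> J" "l \<noteq> j" "l \<noteq> k" for l
    using jk that a_a[of j l] a_a[of k l]
    by (intro f(3)) (simp_all add: d_def algebra_simps adj_diff adj_a_a)
  ultimately show ?thesis
    using f(1) by (intro exI[of _ f]) (auto simp: Transposition.transpose_def)
qed

text \<open>A finite permutation is a product of transpositions, and the automorphisms compose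
  accordingly.\<close>

lemma perm_aut_exists:
  assumes "g permutes I" "finite I" "I \<subseteq> J"
  shows "\<exists>f. star_automorphism f \<and> (\<forall>j\<in>J. f (a j) = a (g j))"
  using assms(1,2)
proof (induction rule: permutes_induct)
  case id
  show ?case using star_automorphism_id by (intro exI[of _ "\<lambda>x. x"]) simp
next
  case (swap j k p)
  then obtain f where f: "star_automorphism f" "\<forall>j\<in>J. f (a j) = a (p j)" by blast
  from swap assms(3) obtain h where
    h: "star_automorphism h" "\<forall>l\<in>J. h (a l) = a (Transposition.transpose j k l)"
    using swap_aut[of j k] by blast
  have "p l \<in> J" if "l \<in> J" for l
    using permutes_in_image[OF permutes_subset[OF swap.hyps(4) assms(3)]] that by blast
  then show ?case
    using f h star_automorphism_comp[OF h(1) f(1)] by (intro exI[of _ "h \<circ> f"]) (auto simp: o_def)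
qed

lemma
  assumes "g permutes I" "finite I" "I \<subseteq> J"
  shows star_automorphism_perm_aut: "star_automorphism (perm_aut J a g)"
    and perm_aut_generator: "j \<in> J \<Longrightarrow> perm_aut J a g (a j) = a (g j)"
  using theI'[OF star_automorphism_unique[OF perm_aut_exists[OF assms]]]
  by (auto simp: perm_aut_def)

lemma flip_aut:
  assumes "finite I" "I \<subseteq> J"
  shows "\<exists>f. star_automorphism f \<and> (\<forall>j\<in>J. f (a j) = (if j \<in> I then - a j else a j))"
  using assms
proof (induction rule: finite_induct)
  case empty
  show ?case using star_automorphism_id by (intro exI[of _ "\<lambda>x. x"]) simp
next
  case (insert k I)
  then obtain f where f: "star_automorphism f"
    "\<forall>j\<in>J. f (a j) = (if j \<in> I then - a j else a j)" and k: "k \<in> J" by blast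
  \<comment> \<open>The factor \<open>sqrt 2\<close> gives the normalization \<open>1 + 1\<close> of
    the anticommutator required by \<open>mode_reflection\<close>.\<close>
  define d where "d = sqrt 2 *\<^sub>R a k"
  have dd: "d * d = 0" by (simp add: d_def a_sq k)
  have ac: "adj d * d + d * adj d = 1 + 1"
    using k by (simp add: d_def adj_scaleR adj_a_a scaleR_2 algebra_simps)
  obtain h where h: "star_automorphism h" "h d = - d"
      "\<And>c. d * c = - (c * d) \<Longrightarrow> adj d * c = - (c * adj d) \<Longrightarrow> h c = c"
    using mode_reflection[OF dd ac] by blast
  have hom: "star_hom h" using h(1) by (simp add: star_automorphism_iff)
  have neg: "h (- x) = - h x" for x
    using star_hom_scaleR[OF hom, of "-1" x] by simp
  have "sqrt 2 *\<^sub>R h (a k) = sqrt 2 *\<^sub>R (- a k)"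
    using h(2) by (simp add: d_def star_hom_scaleR[OF hom])
  then have "h (a k) = - a k" by (simp only: scaleR_cancel_left) simp
  moreover have "h (a l) = a l" if "l \<in> J" "l \<noteq> k" for l
    using k that a_a[of k l] by (intro h(3)) (simp_all add: d_def adj_scaleR adj_a_a)
  ultimately show ?case
    using f star_automorphism_comp[OF h(1) f(1)] insert.hyps(2)
    by (intro exI[of _ "h \<circ> f"]) (auto simp: neg o_def)
qed

end

text \<open>A Cauchy criterion for filters, since the net of finite subsets is not a sequence. The
  centre \<open>y\<close> may vary with \<open>e\<close>; two values near the same \<open>y\<close>
  are near each other.\<close>

lemma cauchy_filter_convergent:
  fixes f :: "'b \<Rightarrow> 'c::complete_space"
  assumes "F \<noteq> bot" "\<And>e. e > 0 \<Longrightarrow> \<exists>y. eventually (\<lambda>x. dist (f x) y < e) F"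
  obtains l where "(f \<longlongrightarrow> l) F"
proof -
  have "cauchy_filter (filtermap f F)"
    unfolding cauchy_filter_metric_filtermap
  proof (intro allI impI)
    fix e :: real assume "e > 0"
    then obtain y where y: "eventually (\<lambda>x. dist (f x) y < e / 2) F"
      using assms(2)[of "e / 2"] by auto
    then show "\<exists>P. eventually P F \<and> (\<forall>x y. P x \<and> P y \<longrightarrow> dist (f x) (f y) < e)"
      using dist_triangle_half_l by blast
  qed
  moreover have "complete (UNIV::'c set)"
    by (meson Cauchy_convergent UNIV_I complete_def convergent_def)
  ultimately show ?thesis
    using complete_uniform[where S = "UNIV::'c set"] assms(1) that
    by (force simp: filterlim_def filtermap_bot_iff)
qed

context car_system begin

text \<open>For infinite \<open>J\<close> the parity, unlike the finite permutations, is not inner, but it is the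
  pointwise limit of the inner automorphisms flipping finitely many modes.\<close>

lemma parity_exists: "\<exists>f. star_automorphism f \<and> (\<forall>j\<in>J. f (a j) = - a j)"
proof -
  let ?F = "finite_subsets_at_top J"
  obtain \<theta> where \<theta>: "\<And>I. finite I \<Longrightarrow> I \<subseteq> J \<Longrightarrow> star_automorphism (\<theta> I)"
    "\<And>I j. finite I \<Longrightarrow> I \<subseteq> J \<Longrightarrow> j \<in> J \<Longrightarrow> \<theta> I (a j) = (if j \<in> I then - a j else a j)"
    using flip_aut by metis
  have ev: "eventually (\<lambda>I. star_automorphism (\<theta> I)) ?F"
    by (rule eventually_finite_subsets_at_top_weakI) (rule \<theta>)
  then have evh: "eventually (\<lambda>I. star_hom (\<theta> I)) ?F"
    by (simp add: star_automorphism_iff eventually_conj_iff)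
  have lim_gen: "((\<lambda>I. \<theta> I (a j)) \<longlongrightarrow> - a j) ?F" if "j \<in> J" for j
  proof (rule tendsto_eventually)
    show "eventually (\<lambda>I. \<theta> I (a j) = - a j) ?F"
      unfolding eventually_finite_subsets_at_top
      using \<theta>(2) that by (intro exI[of _ "{j}"]) auto
  qed
  have lim_one: "((\<lambda>I. \<theta> I 1) \<longlongrightarrow> 1) ?F"
    by (rule tendsto_eventually) (use evh in eventually_elim, rule star_hom_one)
  have lim_add: "((\<lambda>I. \<theta> I (x + y)) \<longlongrightarrow> u + v) ?F"
    if "((\<lambda>I. \<theta> I x) \<longlongrightarrow> u) ?F" "((\<lambda>I. \<theta> I y) \<longlongrightarrow> v) ?F" for x y u v
    by (rule Lim_transform_eventually[OF tendsto_add[OF that]])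
      (use evh in eventually_elim, simp add: star_hom_add)
  have lim_mult: "((\<lambda>I. \<theta> I (x * y)) \<longlongrightarrow> u * v) ?F"
    if "((\<lambda>I. \<theta> I x) \<longlongrightarrow> u) ?F" "((\<lambda>I. \<theta> I y) \<longlongrightarrow> v) ?F" for x y u v
    by (rule Lim_transform_eventually[OF tendsto_mult[OF that]])
      (use evh in eventually_elim, simp add: star_hom_mult)
  have lim_scaleC: "((\<lambda>I. \<theta> I (c *\<^sub>C x)) \<longlongrightarrow> c *\<^sub>C u) ?F"
    if "((\<lambda>I. \<theta> I x) \<longlongrightarrow> u) ?F" for c x u
    by (rule Lim_transform_eventually[OF tendsto_scaleC[OF that]])
      (use evh in eventually_elim, simp add: star_hom_scaleC)
  have lim_adj: "((\<lambda>I. \<theta> I (adj x)) \<longlongrightarrow> adj u) ?F"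
    if "((\<lambda>I. \<theta> I x) \<longlongrightarrow> u) ?F" for x u
    by (rule Lim_transform_eventually[OF tendsto_adj[OF that]])
      (use evh in eventually_elim, simp add: star_hom_adj)
  \<comment> \<open>The elements on which the net converges form a closed *-subalgebra containing
    the generators, hence everything.\<close>
  define B where "B = {x. \<exists>y. ((\<lambda>I. \<theta> I x) \<longlongrightarrow> y) ?F}"
  have "closed_star_subalgebra B"
  proof
    show "unital_star_subalgebra B"
      unfolding unital_star_subalgebra_def B_def
      by (intro conjI ballI allI; (elim CollectE exE)?; intro CollectI exI)
        (rule lim_one, rule lim_add, assumption+, rule lim_mult, assumption+, 
          rule lim_scaleC, assumption, rule lim_adj, assumption)
    \<comment> \<open>The maps \<open>\<theta> I\<close> are contractions, so the net at
      \<open>x\<close> stays uniformly close to the convergent net at a nearby point of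
      \<open>B\<close>.\<close>
    have "x \<in> B" if "x \<in> closure B" for x
    proof -
      obtain y where "((\<lambda>I. \<theta> I x) \<longlongrightarrow> y) ?F"
      proof (rule cauchy_filter_convergent[of ?F "\<lambda>I. \<theta> I x"])
        fix e :: real assume e: "e > 0"
        then obtain x' where x': "x' \<in> B" "dist x' x < e / 2"
          using \<open>x \<in> closure B\<close>[unfolded closure_approachable, rule_format, OF half_gt_zero[OF e]]
          by blast
        then obtain y where "((\<lambda>I. \<theta> I x') \<longlongrightarrow> y) ?F" by (auto simp: B_def)
        then have "eventually (\<lambda>I. dist (\<theta> I x') y < e / 2) ?F"
          using e by (intro tendstoD) auto
        with evh have "eventually (\<lambda>I. dist (\<theta> I x) y < e) ?F"
        proof eventually_elim
          case (elim I)
          interpret bounded_linear "\<theta> I" using elim by (simp add: bounded_linear_star_hom)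
          have "dist (\<theta> I x') (\<theta> I x) \<le> dist x' x"
            using star_hom_norm_le[of "\<theta> I" "x' - x"] elim by (simp add: dist_norm diff)
          then have "dist (\<theta> I x') (\<theta> I x) < e / 2" using x' by simp
          then show ?case
            using dist_triangle_half_r[of "\<theta> I x'" "\<theta> I x" e y] elim by simp
        qed
        then show "\<exists>y. eventually (\<lambda>I. dist (\<theta> I x) y < e) ?F" by blast
      qed simp
      then show ?thesis by (auto simp: B_def)
    qed
    then show "closed B" by (metis closure_subset_eq subsetI)
  qed
  then have "B = UNIV"
    using generated_cstar_minimal[of "a ` J" B] lim_gen generated_UNIV by (auto simp: B_def)
  then have "\<forall>x. \<exists>y. ((\<lambda>I. \<theta> I x) \<longlongrightarrow> y) ?F" by (auto simp: B_def)
  from choice[OF this] obtain f where f: "\<And>x. ((\<lambda>I. \<theta> I x) \<longlongrightarrow> f x) ?F" by blast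
  have uniq: "y = z" if "((\<lambda>I. \<theta> I x) \<longlongrightarrow> y) ?F" "((\<lambda>I. \<theta> I x) \<longlongrightarrow> z) ?F" for x y z
    using that by (rule tendsto_unique[rotated]) simp
  have hom: "star_hom f"
    unfolding star_hom_def
    by (intro conjI allI uniq[OF f lim_one] uniq[OF f lim_add[OF f f]] uniq[OF f lim_mult[OF f f]]
        uniq[OF f lim_scaleC[OF f]] uniq[OF f lim_adj[OF f]])
  have gen: "f (a j) = - a j" if "j \<in> J" for j
    by (rule uniq[OF f lim_gen[OF that]])
  \<comment> \<open>A pointwise limit of bijections need not be bijective; here bijectivity is
    recovered because the limit is an involution.\<close>
  have "f \<circ> f = (\<lambda>x. x)"
  proof (rule star_hom_eqI)
    show "star_hom (f \<circ> f)" using hom hom by (rule star_hom_comp)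
    show "star_hom (\<lambda>x::'a. x)" by (simp add: star_hom_def)
    show "(f \<circ> f) (a j) = a j" if "j \<in> J" for j
      using that gen star_hom_scaleR[OF hom, of "-1" "a j"] by simp
  qed
  then have "bij f" by (intro o_bij[of f f]) (simp_all only: id_def)
  then show ?thesis using hom gen by (auto simp: star_automorphism_iff)
qed

lemma
  shows star_automorphism_parity: "star_automorphism (parity J a)"
    and parity_generator: "j \<in> J \<Longrightarrow> parity J a (a j) = - a j"
  using theI'[OF star_automorphism_unique[OF parity_exists]]
  by (auto simp: parity_def)

lemma star_hom_parity: "star_hom (parity J a)"
  using star_automorphism_parity by (simp add: star_automorphism_iff)

lemma parity_parity: "parity J a (parity J a x) = x"
proof -
  have neg: "parity J a (- y) = - parity J a y" for y
    using star_hom_scaleR[OF star_hom_parity, of "-1" y] by simp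
  have "parity J a \<circ> parity J a = (\<lambda>x. x)"
    by (intro star_hom_eqI star_hom_comp star_hom_parity) (simp_all add: star_hom_def parity_generator neg)
  then show ?thesis by (simp add: fun_eq_iff)
qed

end

section \<open>Averages over finite permutation groups\<close>

text \<open>Composing with the transposition of \<open>k\<close> and \<open>l\<close> matches the
  permutations sending \<open>i\<close> to \<open>l\<close> with those sending \<open>i\<close> to
  \<open>k\<close>, so all these classes have equal size.\<close>

lemma card_permutes_hit:
  assumes "finite I" "i \<in> I" "k \<in> I"
  shows "card {g. g permutes I \<and> g i = k} * card I = card {g. g permutes I}"
proof -
  have eq: "card {g. g permutes I \<and> g i = l} = card {g. g permutes I \<and> g i = k}" if "l \<in> I" for l
  proof (rule bij_betw_same_card)
    show "bij_betw (\<lambda>g. Transposition.transpose k l \<circ> g)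
        {g. g permutes I \<and> g i = l} {g. g permutes I \<and> g i = k}"
      by (rule bij_betw_byWitness[where f' = "\<lambda>g. Transposition.transpose k l \<circ> g"])
        (use assms that in \<open>auto simp: o_assoc intro: permutes_compose permutes_swap_id\<close>)
  qed
  have "{g. g permutes I} = (\<Union>l\<in>I. {g. g permutes I \<and> g i = l})"
    using assms(2) permutes_in_image[of _ I i] by auto
  also have "card \<dots> = (\<Sum>l\<in>I. card {g. g permutes I \<and> g i = l})"
    using assms by (intro card_UN_disjoint) (auto intro: finite_subset[OF _ finite_permutations[OF assms(1)]])
  also have "\<dots> = (\<Sum>l\<in>I. card {g. g permutes I \<and> g i = k})"
    by (intro sum.cong eq refl)
  finally show ?thesis by simp
qed

text \<open>A union bound over the pairs in \<open>K \<times> L\<close>, each pair being hit by the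
  proportion \<open>1 / card I\<close> of the permutations.\<close>

lemma card_permutes_meet_le:
  assumes "finite I" "K \<subseteq> I" "L \<subseteq> I"
  shows "card {g. g permutes I \<and> g ` K \<inter> L \<noteq> {}} * card I
    \<le> card K * card L * card {g. g permutes I}"
proof -
  have fin: "finite K" "finite L" using assms finite_subset by auto
  have "{g. g permutes I \<and> g ` K \<inter> L \<noteq> {}}
      = (\<Union>(i, k)\<in>K \<times> L. {g. g permutes I \<and> g i = k})" by auto
  also have "card \<dots> \<le> (\<Sum>(i, k)\<in>K \<times> L. card {g. g permutes I \<and> g i = k})"
    using fin card_UN_le[of "K \<times> L" "\<lambda>(i, k). {g. g permutes I \<and> g i = k}"]
    by (simp add: case_prod_unfold)
  finally have "card {g. g permutes I \<and> g ` K \<inter> L \<noteq> {}} * card I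
      \<le> (\<Sum>(i, k)\<in>K \<times> L. card {g. g permutes I \<and> g i = k}) * card I"
    by (rule mult_right_mono) simp
  also have "\<dots> = (\<Sum>(i, k)\<in>K \<times> L. card {g. g permutes I})"
    unfolding sum_distrib_right case_prod_unfold
    by (intro sum.cong refl card_permutes_hit) (use assms in auto)
  also have "\<dots> = card K * card L * card {g. g permutes I}"
    by (simp add: case_prod_unfold card_cartesian_product)
  finally show ?thesis .
qed

text \<open>Vector-valued, so that the same average applies to algebra elements and to their scalar
  expectations.\<close>

definition mean :: "'j set \<Rightarrow> (('j \<Rightarrow> 'j) \<Rightarrow> 'a::real_vector) \<Rightarrow> 'a" where
  "mean I f = (1 / real (card {g. g permutes I})) *\<^sub>R (\<Sum>g | g permutes I. f g)"

lemma has_cesaro_mean_iff: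
  "has_cesaro_mean J f c \<longleftrightarrow> ((\<lambda>I. mean I f) \<longlongrightarrow> c) (finite_subsets_at_top J)"
  by (simp add: has_cesaro_mean_def mean_def scaleR_conv_of_real)

lemma card_permutes_pos: "finite I \<Longrightarrow> card {g. g permutes I} > 0"
  by (simp add: card_permutations)

lemma mean_cong: "(\<And>g. g permutes I \<Longrightarrow> f g = h g) \<Longrightarrow> mean I f = mean I h"
  unfolding mean_def by (intro arg_cong[where f = "(*\<^sub>R) _"] sum.cong) auto

lemma mean_const: "finite I \<Longrightarrow> mean I (\<lambda>_. x) = x"
  using card_permutes_pos[of I] by (simp add: mean_def sum_constant_scaleR)

lemma mean_linear: "linear f \<Longrightarrow> f (mean I h) = mean I (\<lambda>g. f (h g))"
  by (simp add: mean_def linear_scale linear_sum)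

lemma mean_add: "mean I (\<lambda>g. f g + h g) = mean I f + mean I h"
  by (simp add: mean_def sum.distrib scaleR_add_right)

lemma mean_inverse: "mean I (\<lambda>g. f (inv g)) = mean I f"
  by (simp add: mean_def sum_permutations_inverse[of f I])

lemma mean_compose_left: "h permutes I \<Longrightarrow> mean I (\<lambda>g. f (h \<circ> g)) = mean I f"
  by (simp add: mean_def setum_permutations_compose_left[of h I f])

text \<open>The quantitative core of both the even and the odd estimate: only the rare permutations
  carrying a point of \<open>K\<close> into \<open>L\<close> contribute.\<close>

lemma norm_mean_meet_le:
  fixes f :: "('j \<Rightarrow> 'j) \<Rightarrow> 'a::real_normed_vector"
  assumes I: "finite I" "K \<subseteq> I" "L \<subseteq> I" "I \<noteq> {}" and c: "c \<ge> 0"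
    and le: "\<And>g. g permutes I \<Longrightarrow> norm (f g) \<le> c"
    and zero: "\<And>g. g permutes I \<Longrightarrow> g ` K \<inter> L = {} \<Longrightarrow> f g = 0"
  shows "norm (mean I f) \<le> c * card K * card L / card I"
proof -
  let ?P = "{g. g permutes I}" and ?M = "{g. g permutes I \<and> g ` K \<inter> L \<noteq> {}}"
  have finP: "finite ?P" using I finite_permutations by blast
  have P: "real (card ?P) > 0" using card_permutes_pos[OF I(1)] by simp
  have cI: "real (card I) > 0" using I by (simp add: card_gt_0_iff)
  have "(\<Sum>g\<in>?P. f g) = (\<Sum>g\<in>?M. f g)"
    by (rule sum.mono_neutral_right[OF finP]) (auto simp: zero)
  also have "norm \<dots> \<le> real (card ?M) * c"
    by (rule order_trans[OF norm_sum]) (rule sum_bounded_above, auto intro: le)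
  finally have "norm (mean I f) \<le> real (card ?M) * c / card ?P"
    using P by (simp add: mean_def divide_simps)
  also have "\<dots> \<le> c * card K * card L / card I"
  proof -
    have "real (card ?M * card I) \<le> real (card K * card L * card ?P)"
      using card_permutes_meet_le[OF I(1-3)] of_nat_le_iff by blast
    then have "c * (real (card ?M) * card I) \<le> c * (real (card K) * card L * card ?P)"
      using c by (intro mult_left_mono) auto
    then show ?thesis
      using P cI by (simp add: field_simps)
  qed
  finally show ?thesis .
qed

lemma norm_mean_le:
  fixes f :: "('j \<Rightarrow> 'j) \<Rightarrow> 'a::real_normed_vector"
  assumes "finite I" "\<And>g. g permutes I \<Longrightarrow> norm (f g) \<le> c"
  shows "norm (mean I f) \<le> c"
proof -
  have "norm (\<Sum>g | g permutes I. f g) \<le> real (card {g. g permutes I}) * c"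
    by (rule order_trans[OF norm_sum]) (rule sum_bounded_above, auto intro: assms)
  then show ?thesis
    using card_permutes_pos[OF assms(1)] by (simp add: mean_def divide_simps mult.commute)
qed

text \<open>An infinite \<open>J\<close> has finite subsets of every size, and cardinality is
  monotone along the net.\<close>

lemma tendsto_inverse_card:
  assumes "infinite J"
  shows "((\<lambda>I. c / real (card I)) \<longlongrightarrow> 0) (finite_subsets_at_top J)"
proof -
  have "filterlim card at_top (finite_subsets_at_top J)"
    unfolding filterlim_at_top
  proof
    fix n :: nat
    obtain K where K: "finite K" "card K = n" "K \<subseteq> J"
      using infinite_arbitrarily_large[OF assms] by blast
    show "eventually (\<lambda>I. n \<le> card I) (finite_subsets_at_top J)"
      unfolding eventually_finite_subsets_at_top
      using K by (intro exI[of _ K]) (auto intro: card_mono)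
  qed
  then have "filterlim (\<lambda>I. real (card I)) at_infinity (finite_subsets_at_top J)"
    by (intro filterlim_at_top_imp_at_infinity filterlim_compose[OF filterlim_real_sequentially])
  then show ?thesis by (intro tendsto_divide_0[OF tendsto_const])
qed

section \<open>Group law and locality of the permutation automorphisms\<close>

context car_system begin

lemma
  assumes "g permutes I" "finite I" "I \<subseteq> J"
  shows star_hom_perm_aut: "star_hom (perm_aut J a g)"
    and norm_perm_aut: "norm (perm_aut J a g x) = norm x"
  using star_automorphism_perm_aut[OF assms]
  by (simp_all add: star_automorphism_iff star_automorphism_norm)

lemma perm_aut_comp:
  assumes g: "g permutes I" and h: "h permutes I" and I: "finite I" "I \<subseteq> J"
  shows "perm_aut J a (g \<circ> h) x = perm_aut J a g (perm_aut J a h x)"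
proof -
  have "h j \<in> J" if "j \<in> J" for j
    using permutes_in_image[OF permutes_subset[OF h I(2)]] that by blast
  then have "perm_aut J a (g \<circ> h) = perm_aut J a g \<circ> perm_aut J a h"
    using g h I permutes_compose[OF h g]
    by (intro star_hom_eqI star_hom_comp star_hom_perm_aut) (simp_all add: perm_aut_generator)
  then show ?thesis by simp
qed

lemma perm_aut_id: "perm_aut J a id x = x"
proof -
  have id: "id permutes {}" by simp
  have "perm_aut J a id = (\<lambda>x. x)"
    using star_hom_perm_aut[OF id] perm_aut_generator[OF id]
    by (intro star_hom_eqI) (simp_all add: star_hom_def)
  then show ?thesis by simp
qed

lemma perm_aut_inv:
  assumes "g permutes I" "finite I" "I \<subseteq> J"
  shows "perm_aut J a g (perm_aut J a (inv g) x) = x"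
  using perm_aut_comp[OF assms(1) permutes_inv[OF assms(1)] assms(2,3), of x]
  by (simp add: permutes_inv_o[OF assms(1)] perm_aut_id)

lemma perm_aut_parity:
  assumes "g permutes I" "finite I" "I \<subseteq> J"
  shows "perm_aut J a g (parity J a x) = parity J a (perm_aut J a g x)"
proof -
  have neg: "perm_aut J a g (- x) = - perm_aut J a g x" for x
    using star_hom_scaleR[OF star_hom_perm_aut[OF assms], of "-1" x] by simp
  have "g j \<in> J" if "j \<in> J" for j
    using permutes_in_image[OF permutes_subset[OF assms(1,3)]] that by blast
  then have "perm_aut J a g \<circ> parity J a = parity J a \<circ> perm_aut J a g"
    by (intro star_hom_eqI star_hom_comp star_hom_perm_aut[OF assms] star_hom_parity)
      (simp_all add: perm_aut_generator[OF assms] parity_generator neg)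
  then show ?thesis by (simp add: fun_eq_iff)
qed

lemma perm_aut_local:
  assumes "g permutes I" "finite I" "I \<subseteq> J" and "K \<subseteq> J" "x \<in> generated_cstar (a ` K)"
  shows "perm_aut J a g x \<in> generated_cstar (a ` g ` K)"
proof -
  have "generated_cstar (a ` K) \<subseteq> perm_aut J a g -` generated_cstar (a ` g ` K)"
  proof (intro generated_cstar_minimal closed_star_subalgebra_vimage star_hom_perm_aut[OF assms(1-3)]
      closed_star_subalgebra_generated subsetI vimageI2)
    fix y assume "y \<in> a ` K"
    then obtain j where j: "j \<in> K" "y = a j" by blast
    then have "perm_aut J a g y = a (g j)"
      using assms(4) by (auto simp: perm_aut_generator[OF assms(1-3)])
    then show "perm_aut J a g y \<in> generated_cstar (a ` g ` K)"
      using j by (simp add: generated_cstar_inc)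
  qed
  then show ?thesis using assms(5) by blast
qed

lemma parity_local:
  assumes "K \<subseteq> J" "x \<in> generated_cstar (a ` K)"
  shows "parity J a x \<in> generated_cstar (a ` K)"
proof -
  have "generated_cstar (a ` K) \<subseteq> parity J a -` generated_cstar (a ` K)"
  proof (intro generated_cstar_minimal closed_star_subalgebra_vimage star_hom_parity
      closed_star_subalgebra_generated subsetI vimageI2)
    fix y assume y: "y \<in> a ` K"
    then have "parity J a y = - y" using assms(1) by (auto simp: parity_generator)
    then show "parity J a y \<in> generated_cstar (a ` K)"
      using y closed_star_subalgebra_generated by (auto intro: subalgebra_minus generated_cstar_inc)
  qed
  then show ?thesis using assms(2) by blast
qed

section \<open>Graded commutation of elements with disjoint modes\<close>

text \<open>The relations for \<open>b\<close> and for \<open>adj b\<close> are carried together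
  because taking adjoints exchanges them; jointly they define a closed *-subalgebra.\<close>

lemma graded_commute_generators:
  assumes b: "parity J a b = - b" and L: "L \<subseteq> J"
    and ac: "\<And>j. j \<in> L \<Longrightarrow> a j * b = - (b * a j)"
      "\<And>j. j \<in> L \<Longrightarrow> a j * adj b = - (adj b * a j)"
    and x: "x \<in> generated_cstar (a ` L)"
  shows "x * b = b * parity J a x \<and> x * adj b = adj b * parity J a x"
proof -
  let ?p = "parity J a"
  note hom = star_hom_add[OF star_hom_parity] star_hom_mult[OF star_hom_parity]
    star_hom_one[OF star_hom_parity] star_hom_scaleC[OF star_hom_parity] star_hom_adj[OF star_hom_parity]
  note cont = linear_continuous_on[OF bounded_linear_star_hom[OF star_hom_parity]]
  define B where "B = {x. x * b = b * ?p x \<and> x * adj b = adj b * ?p x}"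
  \<comment> \<open>The adjoint of the relation for \<open>adj c\<close> has the parity on the wrong
    factor; applying the parity, an involution, repairs this.\<close>
  have adj_B: "adj x * c = c * ?p (adj x)"
    if c: "?p c = - c" and x: "x * adj c = adj c * ?p x" for x c
  proof -
    have "adj (x * adj c) = adj (adj c * ?p x)" by (simp only: x)
    then have "c * adj x = ?p (adj x) * c" by (simp add: adj_mult adj_adj hom)
    then have "?p (c * adj x) = ?p (?p (adj x) * c)" by simp
    then show ?thesis by (simp add: hom(2) c parity_parity)
  qed
  have b': "?p (adj b) = - adj b" by (simp add: hom b adj_minus)
  have "closed_star_subalgebra B"
  proof
    show "closed B"
      unfolding B_def by (intro closed_Collect_conj closed_Collect_eq continuous_intros cont)
    have mult: "x * y * c = c * ?p (x * y)" if "x * c = c * ?p x" "y * c = c * ?p y" for x y c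
      using that by (metis hom(2) mult.assoc)
    show "unital_star_subalgebra B"
      unfolding unital_star_subalgebra_def
    proof (intro conjI ballI allI)
      fix x assume x: "x \<in> B"
      show "c *\<^sub>C x \<in> B" for c
        using x by (simp add: B_def hom mult_scaleC_left mult_scaleC_right)
      show "adj x \<in> B"
        using x adj_B[OF b] adj_B[OF b'] by (simp add: B_def adj_adj)
      show "x + y \<in> B" "x * y \<in> B" if "y \<in> B" for y
        using x that mult[of x _ y] by (simp_all add: B_def hom(1) distrib_left distrib_right)
    qed (simp add: B_def hom)
  qed
  moreover have "a ` L \<subseteq> B"
    using ac L by (auto simp: B_def parity_generator)
  ultimately have "generated_cstar (a ` L) \<subseteq> B" by (intro generated_cstar_minimal)
  then show ?thesis using x by (auto simp: B_def)
qed

lemma graded_commute_generator: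
  assumes "K \<subseteq> J" "l \<in> J - K" "x \<in> generated_cstar (a ` K)"
  shows "x * a l = a l * parity J a x \<and> x * adj (a l) = adj (a l) * parity J a x"
proof (rule graded_commute_generators[OF _ assms(1) _ _ assms(3)])
  fix j assume j: "j \<in> K"
  then have jl: "j \<in> J" "l \<in> J" "l \<noteq> j" using assms by auto
  show "a j * a l = - (a l * a j)" using a_a jl by blast
  show "a j * adj (a l) = - (adj (a l) * a j)" using adj_a_a[of l j] jl by simp
qed (use assms in \<open>simp add: parity_generator\<close>)

lemma even_commute:
  assumes "K \<subseteq> J" "L \<subseteq> J" "K \<inter> L = {}"
    and x: "x \<in> generated_cstar (a ` K)" "parity J a x = x" and y: "y \<in> generated_cstar (a ` L)"
  shows "x * y = y * x"
proof -
  \<comment> \<open>Including \<open>adj x\<close> makes the set stable under adjoints of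
    \<open>y\<close>.\<close>
  define B where "B = {y. x * y = y * x \<and> adj x * y = y * adj x}"
  have x': "adj x \<in> generated_cstar (a ` K)" "parity J a (adj x) = adj x"
    using closed_star_subalgebra_generated[of "a ` K"] x
    by (auto intro: subalgebra_adj simp: star_hom_adj[OF star_hom_parity])
  have "closed_star_subalgebra B"
  proof
    show "closed B"
      unfolding B_def by (intro closed_Collect_conj closed_Collect_eq continuous_intros)
    have adj: "x * adj y = adj y * x" if "adj x * y = y * adj x" for x y :: 'a
      using arg_cong[OF that, of adj] by (simp add: adj_mult adj_adj)
    have mult: "z * (y * w) = y * w * z" if "z * y = y * z" "z * w = w * z" for y w z :: 'a
      using that by (metis mult.assoc)
    show "unital_star_subalgebra B"
      unfolding unital_star_subalgebra_def
    proof (intro conjI ballI allI)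
      fix y assume y: "y \<in> B"
      show "c *\<^sub>C y \<in> B" for c
        using y by (simp add: B_def mult_scaleC_left mult_scaleC_right)
      show "adj y \<in> B"
        using y adj[of x y] adj[of "adj x" y] by (simp add: B_def adj_adj)
      show "y + z \<in> B" "y * z \<in> B" if "z \<in> B" for z
        using y that mult[of _ y z] by (simp_all add: B_def distrib_left distrib_right)
    qed (simp add: B_def)
  qed
  moreover have "a ` L \<subseteq> B"
  proof (rule image_subsetI)
    fix l assume "l \<in> L"
    then have "l \<in> J - K" using assms(2,3) by blast
    then show "a l \<in> B"
      using graded_commute_generator[OF assms(1) _ x(1)] graded_commute_generator[OF assms(1) _ x'(1)]
      by (simp add: B_def x x')
  qed
  ultimately have "generated_cstar (a ` L) \<subseteq> B" by (intro generated_cstar_minimal)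
  then show ?thesis using y by (auto simp: B_def)
qed

lemma odd_anticommute:
  assumes "K \<subseteq> J" "L \<subseteq> J" "K \<inter> L = {}"
    and x: "x \<in> generated_cstar (a ` K)" "parity J a x = - x"
    and y: "y \<in> generated_cstar (a ` L)" "parity J a y = - y"
  shows "y * x = - (x * y)"
proof -
  \<comment> \<open>Generators over \<open>L\<close> anticommute with the odd \<open>x\<close> and
    with its adjoint, so \<open>x\<close> can play the role of \<open>b\<close> in the graded
    relation.\<close>
  have "y * x = x * parity J a y \<and> y * adj x = adj x * parity J a y"
  proof (rule graded_commute_generators[OF x(2) assms(2) _ _ y(1)])
    fix l assume "l \<in> L"
    then have *: "x * a l = - (a l * x)" "x * adj (a l) = - (adj (a l) * x)"
      using graded_commute_generator[OF assms(1) _ x(1), of l] assms by (auto simp: x)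
    then show "a l * x = - (x * a l)" by simp
    show "a l * adj x = - (adj x * a l)"
      using arg_cong[OF *(2), of adj] by (simp add: adj_mult adj_adj adj_minus)
  qed
  then show ?thesis by (simp add: y)
qed

section \<open>Averages of algebra elements and their norm estimates\<close>

definition perm_mean :: "'j set \<Rightarrow> 'a \<Rightarrow> 'a" where
  "perm_mean I x = mean I (\<lambda>g. perm_aut J a g x)"

context
  fixes I assumes I: "finite I" "I \<subseteq> J"
begin

lemma perm_mean_add: "perm_mean I (x + y) = perm_mean I x + perm_mean I y"
  unfolding perm_mean_def mean_add[symmetric]
  by (intro mean_cong) (simp add: star_hom_add[OF star_hom_perm_aut[OF _ I]])

lemma perm_mean_scaleC: "perm_mean I (c *\<^sub>C x) = c *\<^sub>C perm_mean I x"
  unfolding perm_mean_def mean_linear[OF bounded_linear.linear[OF bounded_linear_scaleC]]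
  by (intro mean_cong) (simp add: star_hom_scaleC[OF star_hom_perm_aut[OF _ I]])

lemma perm_mean_adj: "perm_mean I (adj x) = adj (perm_mean I x)"
  unfolding perm_mean_def mean_linear[OF bounded_linear.linear[OF bounded_linear_adj]]
  by (intro mean_cong) (simp add: star_hom_adj[OF star_hom_perm_aut[OF _ I]])

lemma perm_mean_one: "perm_mean I 1 = 1"
proof -
  have "perm_mean I 1 = mean I (\<lambda>_. 1)"
    unfolding perm_mean_def by (intro mean_cong) (simp add: star_hom_one[OF star_hom_perm_aut[OF _ I]])
  then show ?thesis by (simp add: mean_const I)
qed

lemma perm_mean_diff: "perm_mean I (x - y) = perm_mean I x - perm_mean I y"
  using perm_mean_add[of "x - y" y] by simp

lemma norm_perm_mean_le: "norm (perm_mean I x) \<le> norm x"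
  unfolding perm_mean_def by (intro norm_mean_le I) (simp add: norm_perm_aut[OF _ I])

lemma perm_aut_perm_mean:
  assumes "h permutes I"
  shows "perm_aut J a h (perm_mean I x) = perm_mean I x"
proof -
  have "perm_aut J a h (perm_mean I x) = mean I (\<lambda>g. perm_aut J a h (perm_aut J a g x))"
    unfolding perm_mean_def
    by (intro mean_linear bounded_linear.linear bounded_linear_star_hom star_hom_perm_aut[OF assms I])
  also have "\<dots> = mean I (\<lambda>g. perm_aut J a (h \<circ> g) x)"
    by (intro mean_cong) (simp add: perm_aut_comp[OF assms _ I])
  finally show ?thesis
    using mean_compose_left[OF assms, of "\<lambda>g. perm_aut J a g x"] by (simp add: perm_mean_def)
qed

text \<open>A translate of the even \<open>x\<close> commutes with \<open>y\<close> as soon as its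
  modes avoid \<open>L\<close>, so only the rare permutations that carry a point of \<open>K\<close>
  into \<open>L\<close> count.\<close>

lemma even_perm_mean_commutator:
  assumes "K \<subseteq> I" "L \<subseteq> I" "I \<noteq> {}"
    and x: "x \<in> generated_cstar (a ` K)" "parity J a x = x" and y: "y \<in> generated_cstar (a ` L)"
  shows "norm (commutator (perm_mean I x) y) \<le> 2 * norm x * norm y * card K * card L / card I"
proof -
  have "linear (\<lambda>z. z * y - y * z)"
    by (intro linear_compose_sub bounded_linear.linear bounded_linear_mult_left bounded_linear_mult_right)
  then have "commutator (perm_mean I x) y
      = mean I (\<lambda>g. perm_aut J a g x * y - y * perm_aut J a g x)"
    unfolding commutator_def perm_mean_def by (rule mean_linear)
  also have "norm \<dots> \<le> (2 * norm x * norm y) * card K * card L / card I"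
  proof (rule norm_mean_meet_le[OF I(1) assms(1-3)])
    fix g assume g: "g permutes I"
    show "norm (perm_aut J a g x * y - y * perm_aut J a g x) \<le> 2 * norm x * norm y"
      using norm_mult_ineq[of "perm_aut J a g x" y] norm_mult_ineq[of y "perm_aut J a g x"]
        norm_triangle_ineq4[of "perm_aut J a g x * y" "y * perm_aut J a g x"]
      by (simp add: norm_perm_aut[OF g I] mult.commute[of "norm y"])
    assume dj: "g ` K \<inter> L = {}"
    have "g ` K \<subseteq> I" using assms(1) permutes_image[OF g] by blast
    then have "perm_aut J a g x * y = y * perm_aut J a g x"
      using assms I g dj
      by (intro even_commute[of "g ` K" L] perm_aut_local[OF g I])
        (auto simp flip: perm_aut_parity[OF g I])
    then show "perm_aut J a g x * y - y * perm_aut J a g x = 0" by simp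
  qed simp
  finally show ?thesis .
qed

text \<open>The mean \<open>S\<close> of a self-adjoint element \<open>x\<close> is invariant, so \<open>2 S\<^sup>2\<close> is the mean of the
  anticommutators of \<open>x\<close> and \<open>S\<close>.\<close>

lemma odd_perm_mean:
  assumes "K \<subseteq> I" "I \<noteq> {}"
    and x: "x \<in> generated_cstar (a ` K)" "parity J a x = - x" "adj x = x"
  shows "(norm (perm_mean I x))\<^sup>2 \<le> (norm x)\<^sup>2 * (card K)\<^sup>2 / card I"
proof -
  define S where "S = perm_mean I x"
  have adjS: "adj S = S" by (simp add: S_def perm_mean_adj[symmetric] x)
  have "linear (\<lambda>z. z * S + S * z)"
    by (intro linear_compose_add bounded_linear.linear bounded_linear_mult_left bounded_linear_mult_right)
  then have "S * S + S * S = mean I (\<lambda>g. perm_aut J a g x * S + S * perm_aut J a g x)"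
    unfolding S_def perm_mean_def by (subst mean_linear[symmetric]) auto
  also have "\<dots> = perm_mean I (x * S + S * x)"
    unfolding perm_mean_def
  proof (rule mean_cong)
    fix g assume g: "g permutes I"
    have "perm_aut J a g S = S" using perm_aut_perm_mean[OF g] by (simp add: S_def)
    then show "perm_aut J a g x * S + S * perm_aut J a g x = perm_aut J a g (x * S + S * x)"
      by (simp add: star_hom_add[OF star_hom_perm_aut[OF g I]] star_hom_mult[OF star_hom_perm_aut[OF g I]])
  qed
  finally have "2 * norm (S * S) \<le> norm (x * S + S * x)"
    using norm_perm_mean_le[of "x * S + S * x"] norm_scaleR[of 2 "S * S"] by (simp add: scaleR_2)
  \<comment> \<open>Expanding the remaining \<open>S\<close> leaves anticommutators of
    \<open>x\<close> with its translates; they vanish when the permutation moves \<open>K\<close>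
    off itself.\<close>
  also have "x * S + S * x = mean I (\<lambda>g. x * perm_aut J a g x + perm_aut J a g x * x)"
  proof -
    have "linear (\<lambda>z. x * z + z * x)"
      by (intro linear_compose_add bounded_linear.linear bounded_linear_mult_left bounded_linear_mult_right)
    then show ?thesis unfolding S_def perm_mean_def by (rule mean_linear)
  qed
  also have "norm \<dots> \<le> (2 * (norm x)\<^sup>2) * card K * card K / card I"
  proof (rule norm_mean_meet_le[OF I(1) assms(1) assms(1,2)])
    fix g assume g: "g permutes I"
    show "norm (x * perm_aut J a g x + perm_aut J a g x * x) \<le> 2 * (norm x)\<^sup>2"
      using norm_mult_ineq[of "perm_aut J a g x" x] norm_mult_ineq[of x "perm_aut J a g x"]
        norm_triangle_ineq[of "x * perm_aut J a g x" "perm_aut J a g x * x"]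
      by (simp add: norm_perm_aut[OF g I] power2_eq_square)
    assume dj: "g ` K \<inter> K = {}"
    have "g ` K \<subseteq> I" using assms(1) permutes_image[OF g] by blast
    moreover have "parity J a (perm_aut J a g x) = - perm_aut J a g x"
      using star_hom_scaleR[OF star_hom_perm_aut[OF g I], of "-1" x]
      by (simp flip: perm_aut_parity[OF g I] add: x)
    ultimately have "x * perm_aut J a g x = - (perm_aut J a g x * x)"
      using assms I dj
      by (intro odd_anticommute[of "g ` K" K] perm_aut_local[OF g I]) auto
    then show "x * perm_aut J a g x + perm_aut J a g x * x = 0" by simp
  qed simp
  also have "norm (S * S) = (norm S)\<^sup>2" using cstar_identity[of S] by (simp add: adjS)
  finally show ?thesis by (simp add: S_def power2_eq_square mult.assoc)
qed

end

section \<open>Density of local elements and reduction of limits to them\<close>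

definition local_elements :: "'a set" where
  "local_elements = (\<Union>K\<in>{K. finite K \<and> K \<subseteq> J}. generated_cstar (a ` K))"

lemma closure_local_elements: "closure local_elements = UNIV"
proof -
  have alg: "unital_star_subalgebra (generated_cstar (a ` K))" for K
    using closed_star_subalgebra_generated by blast
  \<comment> \<open>The local algebras are directed: two of them lie in the one over the union of
    their mode sets. Hence their union is an algebra.\<close>
  have pair: "\<exists>K. finite K \<and> K \<subseteq> J \<and> x \<in> generated_cstar (a ` K) \<and> y \<in> generated_cstar (a ` K)"
    if "x \<in> local_elements" "y \<in> local_elements" for x y
  proof -
    obtain K where "finite K" "K \<subseteq> J" "x \<in> generated_cstar (a ` K)"
      using \<open>x \<in> local_elements\<close> by (auto simp: local_elements_def)
    moreover obtain L where "finite L" "L \<subseteq> J" "y \<in> generated_cstar (a ` L)"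
      using \<open>y \<in> local_elements\<close> by (auto simp: local_elements_def)
    ultimately show ?thesis
      using generated_cstar_mono[of "a ` K" "a ` (K \<union> L)"] generated_cstar_mono[of "a ` L" "a ` (K \<union> L)"]
      by (intro exI[of _ "K \<union> L"]) auto
  qed
  have mem: "x \<in> local_elements" if "finite K" "K \<subseteq> J" "x \<in> generated_cstar (a ` K)" for K x
    using that by (auto simp: local_elements_def)
  have "unital_star_subalgebra local_elements"
    unfolding unital_star_subalgebra_def
  proof (intro conjI ballI allI)
    show "1 \<in> local_elements" by (rule mem[of "{}", OF _ _ subalgebra_one[OF alg]]) auto
    fix x assume x: "x \<in> local_elements"
    then obtain K where K: "finite K" "K \<subseteq> J" "x \<in> generated_cstar (a ` K)"
      using pair[OF x x] by blast
    show "c *\<^sub>C x \<in> local_elements" for c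
      by (rule mem[OF K(1,2) subalgebra_scaleC[OF alg K(3)]])
    show "adj x \<in> local_elements"
      by (rule mem[OF K(1,2) subalgebra_adj[OF alg K(3)]])
    fix y assume "y \<in> local_elements"
    then obtain L where L: "finite L" "L \<subseteq> J" "x \<in> generated_cstar (a ` L)" "y \<in> generated_cstar (a ` L)"
      using pair[OF x] by blast
    show "x + y \<in> local_elements"
      by (rule mem[OF L(1,2) subalgebra_add[OF alg L(3,4)]])
    show "x * y \<in> local_elements"
      by (rule mem[OF L(1,2) subalgebra_mult[OF alg L(3,4)]])
  qed
  then have "generated_cstar (a ` J) \<subseteq> closure local_elements"
  proof (intro generated_cstar_minimal closure_unital_star_subalgebra)
    have "a j \<in> local_elements" if "j \<in> J" for j
      using that by (intro mem[of "{j}"]) (auto intro: generated_cstar_inc)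
    then show "a ` J \<subseteq> closure local_elements" using closure_subset by blast
  qed
  then show ?thesis using generated_UNIV by auto
qed

text \<open>A uniform bound on the maps \<open>T I\<close> lets convergence to zero pass from a
  dense set to the whole algebra.\<close>

lemma tendsto_zero_from_local:
  fixes T :: "'j set \<Rightarrow> 'a \<Rightarrow> 'b::real_normed_vector"
  assumes diff: "\<And>I x y. finite I \<Longrightarrow> I \<subseteq> J \<Longrightarrow> T I (x - y) = T I x - T I y"
    and le: "\<And>I x. finite I \<Longrightarrow> I \<subseteq> J \<Longrightarrow> norm (T I x) \<le> C * norm x"
    and lim: "\<And>x. x \<in> local_elements \<Longrightarrow> ((\<lambda>I. T I x) \<longlongrightarrow> 0) (finite_subsets_at_top J)"
  shows "((\<lambda>I. T I x) \<longlongrightarrow> 0) (finite_subsets_at_top J)"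
proof (rule tendstoI)
  fix e :: real assume e: "e > 0"
  \<comment> \<open>A strictly positive majorant of \<open>C\<close>, to be divided by; the sign of
    \<open>C\<close> is not known.\<close>
  define D where "D = \<bar>C\<bar> + 1"
  have D: "D > 0" "C \<le> D" by (auto simp: D_def)
  have "x \<in> closure local_elements" by (simp add: closure_local_elements)
  then obtain z where z: "z \<in> local_elements" "dist z x < e / (2 * D)"
    unfolding closure_approachable using e D by (meson divide_pos_pos mult_pos_pos zero_less_numeral)
  have "eventually (\<lambda>I. dist (T I z) 0 < e / 2) (finite_subsets_at_top J)"
    using lim[OF z(1)] e by (intro tendstoD) auto
  moreover have "eventually (\<lambda>I. finite I \<and> I \<subseteq> J) (finite_subsets_at_top J)"
    by (rule eventually_finite_subsets_at_top_weakI) simp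
  ultimately show "eventually (\<lambda>I. dist (T I x) 0 < e) (finite_subsets_at_top J)"
  proof eventually_elim
    case (elim I)
    have "norm (T I x - T I z) \<le> C * norm (x - z)"
      using elim le[of I "x - z"] by (simp add: diff)
    also have "\<dots> \<le> D * norm (x - z)"
      by (intro mult_right_mono D) simp
    also have "\<dots> < e / 2"
      using z(2) D by (simp add: dist_norm norm_minus_commute field_simps)
    finally show ?case
      using elim(1) norm_triangle_ineq[of "T I x - T I z" "T I z"] by simp
  qed
qed

lemma eventually_finite_superset:
  "finite K \<Longrightarrow> K \<subseteq> J \<Longrightarrow>
    eventually (\<lambda>I. finite I \<and> I \<subseteq> J \<and> K \<subseteq> I) (finite_subsets_at_top J)"
  unfolding eventually_finite_subsets_at_top by blast

end

section \<open>Norm limits of averages for infinitely many modes\<close>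

locale infinite_car_system = car_system J a for J :: "'j set" and a :: "'j \<Rightarrow> 'a::cstar_algebra" +
  assumes infinite_J: "infinite J"
begin

lemma eventually_nonempty_superset:
  assumes "finite K" "K \<subseteq> J"
  shows "eventually (\<lambda>I. finite I \<and> I \<subseteq> J \<and> K \<subseteq> I \<and> I \<noteq> {}) (finite_subsets_at_top J)"
proof -
  obtain j where "j \<in> J" using infinite_J by fastforce
  with eventually_finite_superset[of "insert j K"] assms show ?thesis
    by (auto elim!: eventually_mono)
qed

lemma odd_selfadj_perm_mean_tendsto:
  assumes K: "finite K" "K \<subseteq> J"
    and x: "x \<in> generated_cstar (a ` K)" "parity J a x = - x" "adj x = x"
  shows "((\<lambda>I. perm_mean I x) \<longlongrightarrow> 0) (finite_subsets_at_top J)"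
proof -
  have "((\<lambda>I. (norm (perm_mean I x))\<^sup>2) \<longlongrightarrow> 0) (finite_subsets_at_top J)"
  proof (rule Lim_null_comparison[OF _ tendsto_inverse_card[OF infinite_J]])
    show "eventually (\<lambda>I. norm ((norm (perm_mean I x))\<^sup>2) \<le> (norm x)\<^sup>2 * (card K)\<^sup>2 / card I)
        (finite_subsets_at_top J)"
      using eventually_nonempty_superset[OF K]
      by eventually_elim (use odd_perm_mean x in simp)
  qed
  then have "((\<lambda>I. norm (perm_mean I x)) \<longlongrightarrow> 0) (finite_subsets_at_top J)"
    using tendsto_real_sqrt by fastforce
  then show ?thesis by (rule tendsto_norm_zero_cancel)
qed

text \<open>\<open>x - parity J a x\<close> is twice the odd part of \<open>x\<close>. Density
  reduces to local \<open>x\<close>, and splitting into self-adjoint parts reduces to the estimate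
  by squares.\<close>

lemma odd_part_perm_mean_tendsto:
  "((\<lambda>I. perm_mean I (x - parity J a x)) \<longlongrightarrow> 0) (finite_subsets_at_top J)"
proof (rule tendsto_zero_from_local[where T = "\<lambda>I x. perm_mean I (x - parity J a x)"])
  interpret p: bounded_linear "parity J a" by (rule bounded_linear_star_hom[OF star_hom_parity])
  fix I x y assume I: "finite I" "I \<subseteq> J"
  show "perm_mean I (x - y - parity J a (x - y))
      = perm_mean I (x - parity J a x) - perm_mean I (y - parity J a y)"
    by (subst perm_mean_diff[OF I, symmetric]) (simp add: p.diff algebra_simps)
  show "norm (perm_mean I (x - parity J a x)) \<le> 2 * norm x"
    using norm_perm_mean_le[OF I, of "x - parity J a x"] norm_triangle_ineq4[of x "parity J a x"]
      star_hom_norm_le[OF star_hom_parity, of x] by linarith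
next
  interpret p: bounded_linear "parity J a" by (rule bounded_linear_star_hom[OF star_hom_parity])
  note hom = star_hom_adj[OF star_hom_parity] star_hom_scaleC[OF star_hom_parity]
  fix x assume "x \<in> local_elements"
  then obtain K where K: "finite K" "K \<subseteq> J" "x \<in> generated_cstar (a ` K)"
    by (auto simp: local_elements_def)
  have alg: "unital_star_subalgebra (generated_cstar (a ` K))"
    using closed_star_subalgebra_generated by blast
  define w where "w = x - parity J a x"
  have w: "w \<in> generated_cstar (a ` K)" "parity J a w = - w"
    using K by (auto simp: w_def p.diff parity_parity intro!: subalgebra_diff[OF alg] parity_local)
  obtain h k where hk: "adj h = h" "adj k = k" "w = h + \<i> *\<^sub>C k"
    "h = (1/2) *\<^sub>C (w + adj w)" "k = (- \<i> / 2) *\<^sub>C (w - adj w)"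
    by (rule selfadj_decomposition)
  have "h \<in> generated_cstar (a ` K)" "k \<in> generated_cstar (a ` K)"
    unfolding hk(4,5) using w(1)
    by (auto intro!: subalgebra_scaleC[OF alg] subalgebra_add[OF alg] subalgebra_diff[OF alg] subalgebra_adj[OF alg])
  \<comment> \<open>Parity commutes with adjoints, so both self-adjoint parts of the odd
    \<open>w\<close> are odd.\<close>
  moreover have "parity J a h = - h" "parity J a k = - k"
    unfolding hk(4,5)
    by (simp_all add: p.add p.diff w hom adj_minus scaleC_minus_right scaleC_add_right scaleC_diff_right)
  ultimately have lim: "((\<lambda>I. perm_mean I h + \<i> *\<^sub>C perm_mean I k) \<longlongrightarrow> 0 + \<i> *\<^sub>C 0) (finite_subsets_at_top J)"
    using K hk(1,2) by (intro tendsto_add tendsto_scaleC odd_selfadj_perm_mean_tendsto) auto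
  have "eventually (\<lambda>I. perm_mean I h + \<i> *\<^sub>C perm_mean I k = perm_mean I w) (finite_subsets_at_top J)"
    by (rule eventually_finite_subsets_at_top_weakI)
      (simp add: hk(3) perm_mean_add perm_mean_scaleC)
  from Lim_transform_eventually[OF lim this]
  show "((\<lambda>I. perm_mean I (x - parity J a x)) \<longlongrightarrow> 0) (finite_subsets_at_top J)"
    by (simp add: w_def scaleC_zero_right)
qed

lemma norm_commutator_le: "norm (commutator x y) \<le> 2 * norm x * norm (y::'a)"
  using norm_mult_ineq[of x y] norm_mult_ineq[of y x] norm_triangle_ineq4[of "x * y" "y * x"]
  by (simp add: commutator_def mult.commute[of "norm y"])

theorem perm_mean_asymptotically_abelian:
  "((\<lambda>I. commutator (perm_mean I x) y) \<longlongrightarrow> 0) (finite_subsets_at_top J)"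
proof (rule tendsto_zero_from_local[where T = "\<lambda>I x. commutator (perm_mean I x) y"])
  fix I x z assume I: "finite I" "I \<subseteq> J"
  show "commutator (perm_mean I (x - z)) y = commutator (perm_mean I x) y - commutator (perm_mean I z) y"
    by (simp add: perm_mean_diff[OF I] commutator_def algebra_simps)
  have "2 * norm (perm_mean I x) * norm y \<le> 2 * norm x * norm y"
    by (intro mult_right_mono mult_left_mono norm_perm_mean_le I) auto
  then show "norm (commutator (perm_mean I x) y) \<le> (2 * norm y) * norm x"
    using norm_commutator_le[of "perm_mean I x" y] by (simp add: mult_ac)
next
  interpret p: bounded_linear "parity J a" by (rule bounded_linear_star_hom[OF star_hom_parity])
  fix x assume "x \<in> local_elements"
  then obtain K where K: "finite K" "K \<subseteq> J" "x \<in> generated_cstar (a ` K)"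
    by (auto simp: local_elements_def)
  show "((\<lambda>I. commutator (perm_mean I x) y) \<longlongrightarrow> 0) (finite_subsets_at_top J)"
  \<comment> \<open>A second density argument, now in \<open>y\<close> with the local
    \<open>x\<close> fixed.\<close>
  proof (rule tendsto_zero_from_local)
    fix I y z assume I: "finite I" "I \<subseteq> J"
    show "commutator (perm_mean I x) (y - z) = commutator (perm_mean I x) y - commutator (perm_mean I x) z"
      by (simp add: commutator_def algebra_simps)
    have "2 * norm (perm_mean I x) * norm y \<le> 2 * norm x * norm y"
      by (intro mult_right_mono mult_left_mono norm_perm_mean_le I) auto
    then show "norm (commutator (perm_mean I x) y) \<le> (2 * norm x) * norm y"
      using norm_commutator_le[of "perm_mean I x" y] by simp
  next
    fix y assume "y \<in> local_elements"
    then obtain L where L: "finite L" "L \<subseteq> J" "y \<in> generated_cstar (a ` L)"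
      by (auto simp: local_elements_def)
    \<comment> \<open>Twice the even part of \<open>x\<close>. Together with
      \<open>x - parity J a x\<close> it adds up to \<open>2 *\<^sub>R x\<close>, which explains the
      factor 1/2 below.\<close>
    define w where "w = x + parity J a x"
    have w: "w \<in> generated_cstar (a ` K)" "parity J a w = w"
      using K closed_star_subalgebra_generated[of "a ` K"]
      by (auto simp: w_def p.add parity_parity add.commute intro!: subalgebra_add parity_local)
    have even: "((\<lambda>I. commutator (perm_mean I w) y) \<longlongrightarrow> 0) (finite_subsets_at_top J)"
    proof (rule Lim_null_comparison[OF _ tendsto_inverse_card[OF infinite_J]])
      show "eventually (\<lambda>I. norm (commutator (perm_mean I w) y)
          \<le> 2 * norm w * norm y * card K * card L / card I) (finite_subsets_at_top J)"
        using eventually_nonempty_superset[of "K \<union> L"] K L w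
        by (auto elim!: eventually_mono intro!: even_perm_mean_commutator)
    qed
    \<comment> \<open>The averages of the odd part tend to zero in norm, so their commutators with a
      fixed \<open>y\<close> do as well.\<close>
    have "((\<lambda>I. commutator (perm_mean I (x - parity J a x)) y) \<longlongrightarrow> 0 * y - y * 0)
        (finite_subsets_at_top J)"
      unfolding commutator_def
      by (rule tendsto_diff[OF tendsto_mult[OF odd_part_perm_mean_tendsto tendsto_const]
            tendsto_mult[OF tendsto_const odd_part_perm_mean_tendsto]])
    then have "((\<lambda>I. commutator (perm_mean I (x - parity J a x)) y) \<longlongrightarrow> 0) (finite_subsets_at_top J)"
      by simp
    from tendsto_scaleR[OF tendsto_const[of "1/2"] tendsto_add[OF this even]]
    have "((\<lambda>I. (1/2) *\<^sub>R (commutator (perm_mean I (x - parity J a x)) y + commutator (perm_mean I w) y))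
        \<longlongrightarrow> 0) (finite_subsets_at_top J)" by simp
    moreover have "eventually (\<lambda>I. (1/2) *\<^sub>R (commutator (perm_mean I (x - parity J a x)) y
        + commutator (perm_mean I w) y) = commutator (perm_mean I x) y) (finite_subsets_at_top J)"
    proof (rule eventually_finite_subsets_at_top_weakI)
      fix I assume "finite I" "I \<subseteq> J"
      then have "commutator (perm_mean I (x - parity J a x)) y + commutator (perm_mean I w) y
          = 2 *\<^sub>R commutator (perm_mean I x) y"
        by (simp add: w_def perm_mean_add perm_mean_diff commutator_def algebra_simps scaleR_2)
      then show "(1/2) *\<^sub>R (commutator (perm_mean I (x - parity J a x)) y
        + commutator (perm_mean I w) y) = commutator (perm_mean I x) y" by simp
    qed
    ultimately show "((\<lambda>I. commutator (perm_mean I x) y) \<longlongrightarrow> 0) (finite_subsets_at_top J)"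
      by (rule Lim_transform_eventually)
  qed
qed

end

section \<open>States\<close>

lemma
  assumes "state \<phi>"
  shows state_scaleC: "\<phi> (c *\<^sub>C x) = c * \<phi> x" and state_nonneg: "\<phi> (adj x * x) \<in> \<real>\<^sub>\<ge>\<^sub>0"
    and state_one: "\<phi> 1 = 1"
  using assms by (auto simp: state_def)

lemma
  assumes "state \<phi>"
  shows state_hermitian: "\<phi> (adj y * x) = cnj (\<phi> (adj x * y))"
    and state_Cauchy_Schwarz:
      "(cmod (\<phi> (adj x * y)))\<^sup>2 \<le> Re (\<phi> (adj x * x)) * Re (\<phi> (adj y * y))"
proof -
  define z z' p q where "z = \<phi> (adj x * y)" and "z' = \<phi> (adj y * x)"
    and "p = Re (\<phi> (adj x * x))" and "q = Re (\<phi> (adj y * y))"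
  note nonneg = state_nonneg[OF assms, unfolded complex_nonneg_Reals_iff]
  have "\<phi> (adj (x + c *\<^sub>C y) * (x + c *\<^sub>C y))
      = \<phi> (adj x * x) + c * z + cnj c * z' + (cnj c * c) * \<phi> (adj y * y)" for c
    by (simp add: adj_add adj_scaleC distrib_left distrib_right blinfun.add_right
        mult_scaleC_left mult_scaleC_right state_scaleC[OF assms] z_def z'_def)
  moreover have "\<phi> (adj x * x) = of_real p" "\<phi> (adj y * y) = of_real q"
    using nonneg[of x] nonneg[of y] by (simp_all add: p_def q_def complex_eq_iff)
  ultimately have expand: "of_real p + c * z + cnj c * z' + (cnj c * c) * of_real q \<in> \<real>\<^sub>\<ge>\<^sub>0" for c
    using state_nonneg[OF assms, of "x + c *\<^sub>C y"] by simp
  have herm: "z' = cnj z"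
    using expand[of 1] expand[of \<i>] by (simp add: complex_nonneg_Reals_iff complex_eq_iff)
  then show "\<phi> (adj y * x) = cnj (\<phi> (adj x * y))" by (simp add: z_def z'_def)
  define n where "n = (cmod z)\<^sup>2"
  have ineq: "0 \<le> p - 2 * t * n + t\<^sup>2 * n * q" for t :: real
  proof -
    have zz: "z * cnj z = of_real n" by (simp add: n_def complex_norm_square[symmetric])
    \<comment> \<open>This phase makes both cross terms real and equal, leaving a real quadratic
      polynomial in \<open>t\<close>.\<close>
    define c where "c = of_real (- t) * cnj z"
    have "c * z + cnj c * z' = of_real (- 2 * t) * (z * cnj z)"
      by (simp add: c_def herm algebra_simps)
    moreover have "cnj c * c = of_real (t\<^sup>2) * (z * cnj z)"
      by (simp add: c_def power2_eq_square algebra_simps)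
    ultimately have "of_real p + c * z + cnj c * z' + (cnj c * c) * of_real q
        = of_real (p - 2 * t * n + t\<^sup>2 * n * q)"
      by (simp add: zz add.assoc)
    with expand[of c] have "complex_of_real (p - 2 * t * n + t\<^sup>2 * n * q) \<in> \<real>\<^sub>\<ge>\<^sub>0"
      by simp
    then show ?thesis by (simp only: complex_nonneg_Reals_iff Re_complex_of_real)
  qed
  have p: "p \<ge> 0" and q: "q \<ge> 0" and n: "n \<ge> 0" using nonneg by (auto simp: p_def q_def n_def)
  have "n \<le> p * q"
  proof (cases "q = 0")
    case True
    have "n = 0"
    proof (rule ccontr)
      assume "n \<noteq> 0"
      \<comment> \<open>For \<open>q = 0\<close> the polynomial is affine, and this \<open>t\<close>
        gives it the value -1.\<close>
      then show False using ineq[of "(p + 1) / (2 * n)"] True by simp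
    qed
    then show ?thesis using True by simp
  next
    case False
    \<comment> \<open>The minimum of the polynomial is at \<open>t = 1 / q\<close>.\<close>
    then show ?thesis using ineq[of "1 / q"] q by (simp add: power2_eq_square field_simps)
  qed
  then show "(cmod (\<phi> (adj x * y)))\<^sup>2 \<le> Re (\<phi> (adj x * x)) * Re (\<phi> (adj y * y))"
    by (simp add: n_def z_def p_def q_def)
qed

lemma state_cmod_le: "state \<phi> \<Longrightarrow> (cmod (\<phi> x))\<^sup>2 \<le> Re (\<phi> (adj x * x))"
  using state_Cauchy_Schwarz[of \<phi> 1 x] by (simp add: state_one)

lemma state_selfadj: "state \<phi> \<Longrightarrow> adj h = h \<Longrightarrow> Im (\<phi> h) = 0"
  using state_hermitian[of \<phi> 1 h] by (simp add: complex_eq_iff)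

lemma mean_nonneg_Reals:
  assumes "\<And>g. g permutes I \<Longrightarrow> f g \<in> (\<real>\<^sub>\<ge>\<^sub>0 :: complex set)"
  shows "mean I f \<in> \<real>\<^sub>\<ge>\<^sub>0"
proof -
  have "sum f {g. g permutes I} \<in> \<real>\<^sub>\<ge>\<^sub>0"
    using assms by (auto simp: complex_nonneg_Reals_iff intro!: sum_nonneg sum.neutral)
  then show ?thesis by (simp add: mean_def complex_nonneg_Reals_iff)
qed

context car_system begin

lemma mean_blinfun:
  fixes \<phi> :: "'a \<Rightarrow>\<^sub>L complex"
  shows "\<phi> (mean I f) = mean I (\<lambda>g. blinfun_apply \<phi> (f g))"
  by (rule mean_linear) (rule bounded_linear.linear[OF blinfun.bounded_linear_right])

text \<open>By linearity the scalar average becomes \<open>\<phi>\<close> at an averaged element, so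
  clustering can be studied through \<open>perm_mean\<close>.\<close>

lemma cesaro_mean_two_point_iff:
  fixes \<phi> :: "'a \<Rightarrow>\<^sub>L complex"
  shows "has_cesaro_mean J (\<lambda>g. blinfun_apply \<phi> (perm_aut J a g x * y)) c \<longleftrightarrow>
    ((\<lambda>I. \<phi> (perm_mean I x * y)) \<longlongrightarrow> c) (finite_subsets_at_top J)"
proof -
  have "\<phi> (perm_mean I x * y) = mean I (\<lambda>g. \<phi> (perm_aut J a g x * y))" for I
    unfolding perm_mean_def mean_linear[OF bounded_linear.linear[OF bounded_linear_mult_left]]
    by (rule mean_blinfun)
  then show ?thesis by (simp add: has_cesaro_mean_iff)
qed

lemma perm_mean_perm_mean:
  assumes "finite I'" "I' \<subseteq> J" "I \<subseteq> I'"
  shows "perm_mean I (perm_mean I' x) = perm_mean I' x"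
proof -
  have fin: "finite I" using assms finite_subset by blast
  have "perm_mean I (perm_mean I' x) = mean I (\<lambda>_. perm_mean I' x)"
    unfolding perm_mean_def[of I]
    by (intro mean_cong perm_aut_perm_mean[OF assms(1,2)] permutes_subset[OF _ assms(3)])
  then show ?thesis by (simp add: mean_const[OF fin])
qed

context
  fixes \<phi> :: "'a \<Rightarrow>\<^sub>L complex" assumes sym: "\<phi> \<in> symmetric_states J a"
begin

lemma symmetric_state: "state \<phi>"
  using sym by (simp add: symmetric_states_def)

lemma state_perm_aut:
  assumes "g permutes I" "finite I" "I \<subseteq> J"
  shows "\<phi> (perm_aut J a g x) = \<phi> x"
proof -
  have "g \<in> finite_perms J" using assms by (auto simp: finite_perms_def)
  then show ?thesis using sym by (auto simp: symmetric_states_def fun_eq_iff)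
qed

lemma state_perm_mean:
  assumes I: "finite I" "I \<subseteq> J"
  shows "\<phi> (perm_mean I x) = \<phi> x"
proof -
  have "\<phi> (perm_mean I x) = mean I (\<lambda>_. \<phi> x)"
    unfolding perm_mean_def mean_blinfun by (intro mean_cong state_perm_aut[OF _ I])
  then show ?thesis by (simp add: mean_const[OF I(1)])
qed

text \<open>Invariance of \<open>\<phi>\<close> moves \<open>g\<close> to the other factor as its
  inverse, and inversion permutes the group.\<close>

lemma state_perm_mean_mult:
  assumes I: "finite I" "I \<subseteq> J"
  shows "\<phi> (perm_mean I x * y) = \<phi> (x * perm_mean I y)"
proof -
  have "\<phi> (perm_mean I x * y) = mean I (\<lambda>g. \<phi> (perm_aut J a g x * y))"
    unfolding perm_mean_def mean_linear[OF bounded_linear.linear[OF bounded_linear_mult_left]]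
    by (rule mean_blinfun)
  also have "\<dots> = mean I (\<lambda>g. \<phi> (x * perm_aut J a (inv g) y))"
  proof (rule mean_cong)
    fix g assume g: "g permutes I"
    have "perm_aut J a g x * y = perm_aut J a g (x * perm_aut J a (inv g) y)"
      by (simp add: star_hom_mult[OF star_hom_perm_aut[OF g I]] perm_aut_inv[OF g I])
    then show "\<phi> (perm_aut J a g x * y) = \<phi> (x * perm_aut J a (inv g) y)"
      by (simp add: state_perm_aut[OF g I])
  qed
  also have "\<dots> = mean I (\<lambda>g. \<phi> (x * perm_aut J a g y))"
    by (rule mean_inverse)
  also have "\<dots> = \<phi> (x * perm_mean I y)"
    unfolding perm_mean_def mean_linear[OF bounded_linear.linear[OF bounded_linear_mult_right]]
    by (rule mean_blinfun[symmetric])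
  finally show ?thesis .
qed

text \<open>Seen through \<open>\<phi>\<close>, the means act like a decreasing family of orthogonal
  projections: the one over the larger set absorbs the other.\<close>

lemma state_perm_mean_perm_mean:
  assumes I: "finite I" "I \<subseteq> J" "I' \<subseteq> I"
  shows "\<phi> (perm_mean I' x * perm_mean I y) = \<phi> (x * perm_mean I y)"
    and "\<phi> (perm_mean I x * perm_mean I' y) = \<phi> (x * perm_mean I y)"
proof -
  have I': "finite I'" "I' \<subseteq> J" using I finite_subset by auto
  show "\<phi> (perm_mean I' x * perm_mean I y) = \<phi> (x * perm_mean I y)"
    by (simp add: state_perm_mean_mult[OF I'] perm_mean_perm_mean[OF I])
  show "\<phi> (perm_mean I x * perm_mean I' y) = \<phi> (x * perm_mean I y)"
    by (simp add: state_perm_mean_mult[OF I', symmetric] perm_mean_perm_mean[OF I]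
        state_perm_mean_mult[OF I(1,2)])
qed

lemma perm_mean_selfadj:
  "finite I \<Longrightarrow> I \<subseteq> J \<Longrightarrow> adj A = A \<Longrightarrow> adj (perm_mean I A) = perm_mean I A"
  by (simp flip: perm_mean_adj)

text \<open>The seminorms of the means decrease along the net, and by Pythagoras the squared distance
  of two comparable means is the difference of their squared seminorms.\<close>

lemma two_point_mean_convergent:
  assumes A: "adj A = A"
  obtains l where "((\<lambda>I. \<phi> (perm_mean I A * B)) \<longlongrightarrow> l) (finite_subsets_at_top J)"
proof (rule cauchy_filter_convergent[of "finite_subsets_at_top J" "\<lambda>I. \<phi> (perm_mean I A * B)"])
  fix e :: real assume e: "e > 0"
  define q where "q I = Re (\<phi> (A * perm_mean I A))" for I
  define Q where "Q = q ` {I. finite I \<and> I \<subseteq> J}"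
  define M where "M = Re (\<phi> (adj B * B))"
  have M: "M \<ge> 0"
    using state_nonneg[OF symmetric_state, of B] by (simp add: M_def complex_nonneg_Reals_iff)
  have q: "q I = Re (\<phi> (adj (perm_mean I A) * perm_mean I A))" if "finite I" "I \<subseteq> J" for I
    using that state_perm_mean_perm_mean(1)[of I I A A] by (simp add: q_def perm_mean_selfadj A)
  have "q I \<ge> 0" if "finite I" "I \<subseteq> J" for I
    using state_nonneg[OF symmetric_state, of "perm_mean I A"] q[OF that]
    by (simp add: complex_nonneg_Reals_iff)
  then have bdd: "bdd_below Q" by (auto simp: Q_def intro!: bdd_belowI[of _ 0])
  \<comment> \<open>The denominator \<open>M + 1\<close> ensures \<open>d * M < e\<^sup>2\<close>,
    also when \<open>M = 0\<close>.\<close>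
  define d where "d = e\<^sup>2 / (M + 1)"
  have d: "d > 0" using e M by (simp add: d_def)
  have "Q \<noteq> {}" by (auto simp: Q_def)
  \<comment> \<open>From a set nearly attaining the infimum onwards, \<open>q\<close> can drop by at
    most \<open>d\<close>.\<close>
  then obtain I0 where I0: "finite I0" "I0 \<subseteq> J" "q I0 < Inf Q + d"
    using cInf_lessD[of Q "Inf Q + d"] d by (auto simp: Q_def)
  have "dist (\<phi> (perm_mean I A * B)) (\<phi> (perm_mean I0 A * B)) < e"
    if I: "finite I" "I \<subseteq> J" "I0 \<subseteq> I" for I
  proof -
    define X where "X = perm_mean I A - perm_mean I0 A"
    have X: "adj X = X" using I I0 by (simp add: X_def adj_diff perm_mean_selfadj A)
    \<comment> \<open>Both cross terms equal \<open>q I\<close>, so one of them cancels against the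
      square term.\<close>
    have "Re (\<phi> (adj X * X)) = q I0 - q I"
      unfolding X unfolding X_def
      using I I0 state_perm_mean_perm_mean[of I I0 A A] state_perm_mean_perm_mean[of I I A A]
        state_perm_mean_perm_mean[of I0 I0 A A]
      by (simp add: q_def left_diff_distrib right_diff_distrib blinfun.diff_right)
    also have "\<dots> \<le> d"
      using I0(3) cInf_lower[OF _ bdd, of "q I"] I by (auto simp: Q_def)
    finally have Xd: "Re (\<phi> (adj X * X)) \<le> d" .
    have "(cmod (\<phi> (adj X * B)))\<^sup>2 \<le> Re (\<phi> (adj X * X)) * M"
      unfolding M_def by (rule state_Cauchy_Schwarz[OF symmetric_state])
    also have "\<dots> \<le> d * M" using Xd M by (rule mult_right_mono)
    also have "\<dots> < e\<^sup>2"
      using e M by (simp add: d_def divide_simps)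
    finally have "cmod (\<phi> (X * B)) < e"
      using e by (simp add: X power_less_imp_less_base)
    then show ?thesis by (simp add: X_def dist_norm left_diff_distrib blinfun.diff_right)
  qed
  then show "\<exists>y. eventually (\<lambda>I. dist (\<phi> (perm_mean I A * B)) y < e) (finite_subsets_at_top J)"
    using eventually_finite_superset[OF I0(1,2)]
    by (intro exI[of _ "\<phi> (perm_mean I0 A * B)"]) (auto elim!: eventually_mono)
qed (simp_all add: that)

end

end

section \<open>Evenness and asymptotic abelianness\<close>

context infinite_car_system begin

text \<open>\<open>\<phi>\<close> takes the same value on \<open>x - parity J a x\<close> as on its
  averages, which tend to zero in norm.\<close>

theorem symmetric_state_even:
  assumes "\<phi> \<in> symmetric_states J a"
  shows "\<phi> (parity J a x) = \<phi> x"
proof -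
  let ?F = "finite_subsets_at_top J"
  have "((\<lambda>I. \<phi> (perm_mean I (x - parity J a x))) \<longlongrightarrow> \<phi> 0) ?F"
    by (intro tendsto_intros odd_part_perm_mean_tendsto)
  moreover have "eventually (\<lambda>I. \<phi> (perm_mean I (x - parity J a x)) = \<phi> (x - parity J a x)) ?F"
    by (rule eventually_finite_subsets_at_top_weakI) (rule state_perm_mean[OF assms])
  ultimately have "((\<lambda>I. \<phi> (x - parity J a x)) \<longlongrightarrow> \<phi> 0) ?F"
    by (rule Lim_transform_eventually)
  then have "\<phi> (x - parity J a x) = \<phi> 0"
    by (simp only: tendsto_const_iff[OF finite_subsets_at_top_neq_bot])
  then show ?thesis by (simp add: blinfun.diff_right)
qed

text \<open>Linearity brings the average into the commutator, which then tends to zero in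
  norm.\<close>

theorem bounded_functional_asymptotically_abelian:
  "asymptotically_abelian_in_average J a \<phi>"
  unfolding asymptotically_abelian_in_average_def has_cesaro_mean_iff
proof (intro allI)
  fix A B C D
  have lin: "linear (\<lambda>x. \<phi> (C * commutator x B * D))"
    by (rule linearI) (simp_all add: commutator_def blinfun.add_right blinfun.scaleR_right
        blinfun.diff_right algebra_simps)
  have "mean I (\<lambda>g. \<phi> (C * commutator (perm_aut J a g A) B * D))
      = \<phi> (C * commutator (perm_mean I A) B * D)" for I
    unfolding perm_mean_def by (rule mean_linear[OF lin, symmetric])
  moreover have "((\<lambda>I. \<phi> (C * commutator (perm_mean I A) B * D)) \<longlongrightarrow> \<phi> (C * 0 * D))
      (finite_subsets_at_top J)"
    by (intro tendsto_intros perm_mean_asymptotically_abelian)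
  ultimately show "((\<lambda>I. mean I (\<lambda>g. \<phi> (C * commutator (perm_aut J a g A) B * D))) \<longlongrightarrow> 0)
      (finite_subsets_at_top J)" by simp
qed

section \<open>Weak clustering implies extremality\<close>

text \<open>For \<open>A\<close> centred at its expectation, clustering makes the
  \<open>\<phi>\<close>-seminorm of its averages tend to zero; domination transfers this to
  \<open>\<psi>\<close>, which does not see the averaging.\<close>

lemma weakly_clustering_dominated:
  assumes \<phi>: "\<phi> \<in> symmetric_states J a" "weakly_clustering J a \<phi>"
    and \<psi>: "\<psi> \<in> symmetric_states J a" and t: "t > 0"
    and dom: "\<And>x. t * Re (\<psi> (adj x * x)) \<le> Re (\<phi> (adj x * x))"
  shows "\<psi> = \<phi>"
proof (rule blinfun_eqI)
  fix A
  let ?F = "finite_subsets_at_top J"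
  note st = symmetric_state[OF \<phi>(1)] and st' = symmetric_state[OF \<psi>]
  define X where "X = A - \<phi> A *\<^sub>C 1"
  have X: "\<phi> X = 0" by (simp add: X_def blinfun.diff_right state_scaleC[OF st] state_one[OF st])
  have "((\<lambda>I. \<phi> (perm_mean I (adj X) * X)) \<longlongrightarrow> \<phi> (adj X) * \<phi> X) ?F"
    using \<phi>(2) unfolding weakly_clustering_def cesaro_mean_two_point_iff by blast
  then have "((\<lambda>I. Re (\<phi> (perm_mean I (adj X) * X)) / t) \<longlongrightarrow> Re 0 / t) ?F"
    unfolding X mult_zero_right using t by (intro tendsto_intros) auto
  moreover have "eventually (\<lambda>I. (cmod (\<psi> X))\<^sup>2 \<le> Re (\<phi> (perm_mean I (adj X) * X)) / t) ?F"
  proof (rule eventually_finite_subsets_at_top_weakI)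
    fix I assume I: "finite I" "I \<subseteq> J"
    have "(cmod (\<psi> X))\<^sup>2 = (cmod (\<psi> (perm_mean I X)))\<^sup>2"
      by (simp add: state_perm_mean[OF \<psi> I])
    also have "\<dots> \<le> Re (\<psi> (adj (perm_mean I X) * perm_mean I X))"
      by (rule state_cmod_le[OF st'])
    also have "\<dots> \<le> Re (\<phi> (adj (perm_mean I X) * perm_mean I X)) / t"
      using dom t by (simp add: field_simps)
    \<comment> \<open>Merging the two means into one produces a two-point average, to which
      clustering applies.\<close>
    also have "\<phi> (adj (perm_mean I X) * perm_mean I X) = \<phi> (perm_mean I (adj X) * X)"
      using state_perm_mean_perm_mean(1)[OF \<phi>(1) I order_refl, of "adj X" X]
      by (simp add: perm_mean_adj[OF I, symmetric] state_perm_mean_mult[OF \<phi>(1) I])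
    finally show "(cmod (\<psi> X))\<^sup>2 \<le> Re (\<phi> (perm_mean I (adj X) * X)) / t" .
  qed
  ultimately have "(cmod (\<psi> X))\<^sup>2 \<le> Re 0 / t"
    by (intro tendsto_lowerbound[of _ _ ?F]) auto
  then have "\<psi> X = 0" by simp
  then show "\<psi> A = \<phi> A"
    by (simp add: X_def blinfun.diff_right state_scaleC[OF st'] state_one[OF st'])
qed

theorem weakly_clustering_imp_extreme:
  assumes \<phi>: "\<phi> \<in> symmetric_states J a" "weakly_clustering J a \<phi>"
  shows "\<phi> extreme_point_of symmetric_states J a"
  unfolding extreme_point_of_def
proof (intro conjI ballI notI \<phi>(1))
  fix \<psi> \<omega> assume states: "\<psi> \<in> symmetric_states J a" "\<omega> \<in> symmetric_states J a"
    and "\<phi> \<in> open_segment \<psi> \<omega>"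
  then obtain u where u: "0 < u" "u < 1" "\<phi> = (1 - u) *\<^sub>R \<psi> + u *\<^sub>R \<omega>" and ne: "\<psi> \<noteq> \<omega>"
    unfolding in_segment by blast
  have nonneg: "Re (\<psi> (adj x * x)) \<ge> 0" "Re (\<omega> (adj x * x)) \<ge> 0" for x
    using states[THEN symmetric_state] state_nonneg by (auto simp: complex_nonneg_Reals_iff)
  have eq: "Re (\<phi> x) = (1 - u) * Re (\<psi> x) + u * Re (\<omega> x)" for x
    by (simp add: u(3) blinfun.add_left blinfun.scaleR_left)
  \<comment> \<open>The weight of each endpoint in the convex combination serves as its domination
    constant.\<close>
  have "\<psi> = \<phi>"
    by (rule weakly_clustering_dominated[OF \<phi> states(1), of "1 - u"])
      (use u(1,2) nonneg in \<open>simp_all add: eq\<close>)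
  moreover have "\<omega> = \<phi>"
    by (rule weakly_clustering_dominated[OF \<phi> states(2) u(1)])
      (use u(1,2) nonneg in \<open>simp_all add: eq\<close>)
  ultimately show False using ne by simp
qed

section \<open>Extremality implies weak clustering\<close>

text \<open>Asymptotic abelianness moves the mean of \<open>A\<close> between \<open>x\<^sup>*\<close> and \<open>x\<close>, which gives the
  positivity of the limit functional.\<close>

lemma two_point_limit_state:
  assumes \<phi>: "\<phi> \<in> symmetric_states J a" and A: "A = adj y * y"
    and s: "\<phi> A = of_real s" "s > 0"
    and lim: "\<And>B. ((\<lambda>I. \<phi> (perm_mean I A * B)) \<longlongrightarrow> \<psi> B) (finite_subsets_at_top J)"
  shows "\<exists>\<omega>\<in>symmetric_states J a. \<forall>B. blinfun_apply \<omega> B = \<psi> B / of_real s"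
proof -
  let ?F = "finite_subsets_at_top J"
  note st = symmetric_state[OF \<phi>]
  have uniq: "l = \<psi> B" if "((\<lambda>I. \<phi> (perm_mean I A * B)) \<longlongrightarrow> l) ?F" for l B
    using that lim by (rule tendsto_unique[rotated]) simp
  have add: "\<psi> (x + z) = \<psi> x + \<psi> z" for x z
    using tendsto_add[OF lim[of x] lim[of z]]
    by (intro uniq[symmetric]) (simp add: distrib_left blinfun.add_right)
  have scale: "\<psi> (c *\<^sub>C x) = c * \<psi> x" for c x
    using tendsto_mult[OF tendsto_const[of c] lim[of x]]
    by (intro uniq[symmetric]) (simp add: mult_scaleC_right state_scaleC[OF st])
  have one: "\<psi> 1 = of_real s"
  proof (rule uniq[symmetric, OF tendsto_eventually])
    show "eventually (\<lambda>I. \<phi> (perm_mean I A * 1) = of_real s) ?F"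
      by (rule eventually_finite_subsets_at_top_weakI) (simp add: state_perm_mean[OF \<phi>] s)
  qed
  have bound: "norm (\<psi> B) \<le> norm B * (norm \<phi> * norm A)" for B
  proof (rule Lim_norm_ubound[OF _ lim])
    show "eventually (\<lambda>I. norm (\<phi> (perm_mean I A * B)) \<le> norm B * (norm \<phi> * norm A)) ?F"
    proof (rule eventually_finite_subsets_at_top_weakI)
      fix I assume I: "finite I" "I \<subseteq> J"
      have "norm (\<phi> (perm_mean I A * B)) \<le> norm \<phi> * norm (perm_mean I A * B)"
        by (rule norm_blinfun)
      also have "\<dots> \<le> norm \<phi> * (norm A * norm B)"
        by (intro mult_left_mono order_trans[OF norm_mult_ineq] mult_right_mono norm_perm_mean_le I) auto
      finally show "norm (\<phi> (perm_mean I A * B)) \<le> norm B * (norm \<phi> * norm A)"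
        by (simp add: mult_ac)
    qed
  qed simp
  have pos: "\<psi> (adj x * x) \<in> \<real>\<^sub>\<ge>\<^sub>0" for x
  proof (rule Lim_in_closed_set[of _ _ ?F])
    have "((\<lambda>I. \<phi> (perm_mean I A * (adj x * x)) - \<phi> (commutator (perm_mean I A) (adj x) * x))
        \<longlongrightarrow> \<psi> (adj x * x) - \<phi> (0 * x)) ?F"
      by (intro tendsto_diff lim tendsto_intros perm_mean_asymptotically_abelian)
    then show "((\<lambda>I. \<phi> (adj x * perm_mean I A * x)) \<longlongrightarrow> \<psi> (adj x * x)) ?F"
      by (simp add: commutator_def left_diff_distrib mult.assoc flip: blinfun.diff_right)
    show "eventually (\<lambda>I. \<phi> (adj x * perm_mean I A * x) \<in> \<real>\<^sub>\<ge>\<^sub>0) ?F"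
    proof (rule eventually_finite_subsets_at_top_weakI)
      fix I assume I: "finite I" "I \<subseteq> J"
      have lin: "linear (\<lambda>z. \<phi> (adj x * z * x))"
        by (rule linearI) (simp_all add: blinfun.add_right blinfun.scaleR_right algebra_simps)
      have "\<phi> (adj x * perm_mean I A * x) = mean I (\<lambda>g. \<phi> (adj x * perm_aut J a g A * x))"
        unfolding perm_mean_def by (rule mean_linear[OF lin])
      also have "\<dots> \<in> \<real>\<^sub>\<ge>\<^sub>0"
      proof (rule mean_nonneg_Reals)
        fix g assume g: "g permutes I"
        have "adj x * perm_aut J a g A * x = adj (perm_aut J a g y * x) * (perm_aut J a g y * x)"
          by (simp add: A star_hom_mult[OF star_hom_perm_aut[OF g I]]
              star_hom_adj[OF star_hom_perm_aut[OF g I]] adj_mult mult.assoc)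
        then show "\<phi> (adj x * perm_aut J a g A * x) \<in> \<real>\<^sub>\<ge>\<^sub>0" by (simp add: state_nonneg[OF st])
      qed
      finally show "\<phi> (adj x * perm_mean I A * x) \<in> \<real>\<^sub>\<ge>\<^sub>0" .
    qed
  qed simp_all
  have inv: "\<psi> (perm_aut J a g B) = \<psi> B" if "g \<in> finite_perms J" for g B
  proof -
    obtain K where K: "finite K" "K \<subseteq> J" "g permutes K"
      using \<open>g \<in> finite_perms J\<close> by (auto simp: finite_perms_def)
    \<comment> \<open>Once \<open>I\<close> contains \<open>K\<close>, the mean of \<open>A\<close>
      is fixed by \<open>g\<close>, so \<open>g\<close> can be taken out of the whole
      product.\<close>
    have "eventually (\<lambda>I. \<phi> (perm_mean I A * perm_aut J a g B) = \<phi> (perm_mean I A * B)) ?F"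
      using eventually_finite_superset[OF K(1,2)]
    proof eventually_elim
      case (elim I)
      then have I: "finite I" "I \<subseteq> J" and g: "g permutes I" using permutes_subset[OF K(3)] by auto
      have "perm_mean I A * perm_aut J a g B = perm_aut J a g (perm_mean I A * B)"
        by (simp add: star_hom_mult[OF star_hom_perm_aut[OF g I]] perm_aut_perm_mean[OF I g])
      then show ?case by (simp add: state_perm_aut[OF \<phi> g I])
    qed
    from Lim_transform_eventually[OF lim this] show ?thesis by (rule uniq)
  qed
  have bl: "bounded_linear (\<lambda>B. \<psi> B / of_real s)"
  proof (rule bounded_linear_intro)
    show "\<psi> (x + z) / of_real s = \<psi> x / of_real s + \<psi> z / of_real s" for x z
      by (simp add: add add_divide_distrib)
    show "\<psi> (r *\<^sub>R x) / of_real s = r *\<^sub>R (\<psi> x / of_real s)" for r x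
      by (simp add: scaleR_scaleC scale scaleR_conv_of_real)
    show "norm (\<psi> x / of_real s) \<le> norm x * (norm \<phi> * norm A / s)" for x
      using bound[of x] s(2) by (simp add: norm_divide divide_right_mono)
  qed
  define \<omega> where "\<omega> = Blinfun (\<lambda>B. \<psi> B / of_real s)"
  have \<omega>: "blinfun_apply \<omega> B = \<psi> B / of_real s" for B
    by (simp add: \<omega>_def bounded_linear_Blinfun_apply[OF bl])
  have "state \<omega>"
    unfolding state_def \<omega> using s(2) pos
    by (auto simp: scale one complex_nonneg_Reals_iff)
  then have "\<omega> \<in> symmetric_states J a"
    by (simp add: symmetric_states_def fun_eq_iff \<omega> inv)
  then show ?thesis using \<omega> by blast
qed

text \<open>\<open>A = 1/2 + h\<close> and \<open>1 - A = 1/2 - h\<close> are both positive. Their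
  limit functionals add up to \<open>\<phi>\<close> and, normalized, display it as a convex
  combination of symmetric states.\<close>

lemma extreme_two_point_limit:
  assumes ext: "\<phi> extreme_point_of symmetric_states J a"
    and h: "adj h = h" "norm h < 1/4"
  shows "((\<lambda>I. \<phi> (perm_mean I ((1/2) *\<^sub>R 1 + h) * B)) \<longlongrightarrow> \<phi> ((1/2) *\<^sub>R 1 + h) * \<phi> B)
    (finite_subsets_at_top J)"
proof -
  let ?F = "finite_subsets_at_top J"
  define A where "A = (1/2) *\<^sub>R 1 + h"
  have \<phi>: "\<phi> \<in> symmetric_states J a" using ext by (simp add: extreme_point_of_def)
  note st = symmetric_state[OF \<phi>]
  have adjA: "adj A = A" by (simp add: A_def adj_add adj_scaleR h)
  have re_le: "Re (\<phi> k) \<le> 1/4" if "adj k = k" "norm k < 1/4" for k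
  proof -
    obtain y where "adj y * y = (1/4) *\<^sub>R 1 - k"
      using positive_scaled_one_minus[OF \<open>norm k < 1/4\<close> \<open>adj k = k\<close>] by blast
    then have "\<phi> ((1/4) *\<^sub>R 1 - k) \<in> \<real>\<^sub>\<ge>\<^sub>0" using state_nonneg[OF st, of y] by simp
    then show ?thesis
      by (simp add: blinfun.diff_right blinfun.scaleR_right state_one[OF st] complex_nonneg_Reals_iff)
  qed
  \<comment> \<open>The bound 1/4 on \<open>norm h\<close> keeps \<open>s\<close> between 1/4 and
    3/4, so both normalizations divide by a positive number.\<close>
  define s where "s = 1/2 + Re (\<phi> h)"
  have s: "\<phi> A = of_real s"
    using state_selfadj[OF st h(1)]
    by (simp add: A_def s_def blinfun.add_right blinfun.scaleR_right state_one[OF st] complex_eq_iff)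
  have s01: "0 < s" "0 < 1 - s"
    using re_le[OF h] re_le[of "- h"] h by (auto simp: s_def adj_minus blinfun.minus_right)
  have nh: "norm (- h) < 1/2" "norm h < 1/2" using h by auto
  have "adj (- h) = - h" by (simp add: adj_minus h)
  with nh(1) obtain y where "adj y * y = (1/2) *\<^sub>R 1 - (- h)"
    by (rule positive_scaled_one_minus)
  then have y: "A = adj y * y" by (simp add: A_def)
  obtain z where z: "1 - A = adj z * z"
  proof (rule positive_scaled_one_minus[OF nh(2) h(1)])
    fix z assume "adj z * z = (1/2) *\<^sub>R 1 - h"
    moreover have "1 - A = (1/2) *\<^sub>R 1 - h"
      using scaleR_left_distrib[of "1/2" "1/2" "1::'a"] by (simp add: A_def algebra_simps)
    ultimately show thesis by (intro that[of z]) simp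
  qed
  have "\<forall>B. \<exists>l. ((\<lambda>I. \<phi> (perm_mean I A * B)) \<longlongrightarrow> l) ?F"
    using two_point_mean_convergent[OF \<phi> adjA] by metis
  from choice[OF this] obtain \<psi> where
    \<psi>: "\<And>B. ((\<lambda>I. \<phi> (perm_mean I A * B)) \<longlongrightarrow> \<psi> B) ?F" by blast
  have \<psi>': "((\<lambda>I. \<phi> (perm_mean I (1 - A) * B)) \<longlongrightarrow> \<phi> B - \<psi> B) ?F" for B
  proof (rule Lim_transform_eventually[OF tendsto_diff[OF tendsto_const \<psi>]])
    show "eventually (\<lambda>I. \<phi> B - \<phi> (perm_mean I A * B) = \<phi> (perm_mean I (1 - A) * B)) ?F"
      by (rule eventually_finite_subsets_at_top_weakI)
        (simp add: perm_mean_diff perm_mean_one left_diff_distrib blinfun.diff_right)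
  qed
  have s': "\<phi> (1 - A) = of_real (1 - s)"
    by (simp add: blinfun.diff_right state_one[OF st] s)
  obtain \<omega> where \<omega>: "\<omega> \<in> symmetric_states J a" "\<And>B. blinfun_apply \<omega> B = \<psi> B / of_real s"
    using two_point_limit_state[OF \<phi> y s s01(1) \<psi>] by blast
  obtain \<omega>' where \<omega>': "\<omega>' \<in> symmetric_states J a"
      "\<And>B. blinfun_apply \<omega>' B = (\<phi> B - \<psi> B) / of_real (1 - s)"
    using two_point_limit_state[OF \<phi> z s' s01(2) \<psi>'] by blast
  have comb: "\<phi> = (1 - s) *\<^sub>R \<omega>' + s *\<^sub>R \<omega>"
  proof (rule blinfun_eqI)
    fix B
    have "complex_of_real s \<noteq> 0" "complex_of_real (1 - s) \<noteq> 0"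
      using s01 by (auto simp only: of_real_eq_0_iff)
    then show "\<phi> B = ((1 - s) *\<^sub>R \<omega>' + s *\<^sub>R \<omega>) B"
      by (simp add: blinfun.add_left blinfun.scaleR_left \<omega>(2) \<omega>'(2) scaleR_conv_of_real del: of_real_diff)
  qed
  have "\<omega>' = \<omega>"
  proof (rule ccontr)
    assume "\<omega>' \<noteq> \<omega>"
    then have "\<phi> \<in> open_segment \<omega>' \<omega>"
      unfolding in_segment using comb s01 by (intro conjI exI[of _ s]) auto
    then show False using ext \<omega>(1) \<omega>'(1) by (auto simp: extreme_point_of_def)
  qed
  then have "\<phi> = \<omega>" using comb by (simp flip: scaleR_left_distrib)
  then have "\<psi> B = \<phi> A * \<phi> B" using \<omega>(2)[of B] s s01 by simp
  then show ?thesis using \<psi>[of B] by (simp add: A_def)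
qed

text \<open>The elements \<open>A\<close> that cluster with every \<open>B\<close> form a complex
  subspace; small self-adjoint perturbations of 1/2 already span the algebra.\<close>

theorem extreme_imp_weakly_clustering:
  assumes ext: "\<phi> extreme_point_of symmetric_states J a"
  shows "weakly_clustering J a \<phi>"
proof -
  let ?F = "finite_subsets_at_top J"
  have \<phi>: "\<phi> \<in> symmetric_states J a" using ext by (simp add: extreme_point_of_def)
  note st = symmetric_state[OF \<phi>]
  define C where "C A \<longleftrightarrow> (\<forall>B. ((\<lambda>I. \<phi> (perm_mean I A * B)) \<longlongrightarrow> \<phi> A * \<phi> B) ?F)" for A
  have C_add: "C (x + y)" if "C x" "C y" for x y
    unfolding C_def
  proof
    fix B
    have "((\<lambda>I. \<phi> (perm_mean I x * B) + \<phi> (perm_mean I y * B)) \<longlongrightarrow> \<phi> x * \<phi> B + \<phi> y * \<phi> B) ?F"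
      using that by (intro tendsto_add) (auto simp: C_def)
    moreover have "eventually (\<lambda>I. \<phi> (perm_mean I x * B) + \<phi> (perm_mean I y * B)
        = \<phi> (perm_mean I (x + y) * B)) ?F"
      by (rule eventually_finite_subsets_at_top_weakI)
        (simp add: perm_mean_add distrib_right blinfun.add_right)
    ultimately show "((\<lambda>I. \<phi> (perm_mean I (x + y) * B)) \<longlongrightarrow> \<phi> (x + y) * \<phi> B) ?F"
      unfolding blinfun.add_right distrib_right by (rule Lim_transform_eventually)
  qed
  have C_scale: "C (c *\<^sub>C x)" if "C x" for c x
    unfolding C_def
  proof
    fix B
    have "((\<lambda>I. c * \<phi> (perm_mean I x * B)) \<longlongrightarrow> c * (\<phi> x * \<phi> B)) ?F"
      using that by (intro tendsto_mult tendsto_const) (auto simp: C_def)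
    moreover have "eventually (\<lambda>I. c * \<phi> (perm_mean I x * B) = \<phi> (perm_mean I (c *\<^sub>C x) * B)) ?F"
      by (rule eventually_finite_subsets_at_top_weakI)
        (simp add: perm_mean_scaleC mult_scaleC_left state_scaleC[OF st])
    ultimately show "((\<lambda>I. \<phi> (perm_mean I (c *\<^sub>C x) * B)) \<longlongrightarrow> \<phi> (c *\<^sub>C x) * \<phi> B) ?F"
      unfolding state_scaleC[OF st] mult.assoc by (rule Lim_transform_eventually)
  qed
  have C_half: "C ((1/2) *\<^sub>R 1 + h)" if "adj h = h" "norm h < 1/4" for h
    using extreme_two_point_limit[OF ext that] by (simp add: C_def)
  have C_sa: "C h" if h: "adj h = h" for h
  proof -
    \<comment> \<open>Scales \<open>h\<close> to norm below 1/4; adding 1 makes this strict and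
      covers \<open>h = 0\<close>.\<close>
    define r where "r = 1 / (4 * (norm h + 1))"
    have r: "r > 0" by (simp add: r_def add_nonneg_pos)
    have "norm (r *\<^sub>R h) < 1/4"
      using norm_ge_zero[of h] by (simp add: r_def divide_simps add_nonneg_pos not_less)
    then have "C ((1/2) *\<^sub>R 1 + r *\<^sub>R h)" by (intro C_half) (simp_all add: adj_scaleR h)
    moreover have "C ((1/2) *\<^sub>R 1)" using C_half[of 0] by (simp add: adj_zero)
    \<comment> \<open>Removing the summand 1/2 and undoing the scaling recovers
      \<open>h\<close>.\<close>
    ultimately have "C (complex_of_real (1 / r) *\<^sub>C
        (((1/2) *\<^sub>R 1 + r *\<^sub>R h) + complex_of_real (- 1) *\<^sub>C ((1/2) *\<^sub>R 1)))"
      by (rule C_scale[OF C_add[OF _ C_scale]])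
    also have "complex_of_real (1 / r) *\<^sub>C
        (((1/2) *\<^sub>R 1 + r *\<^sub>R h) + complex_of_real (- 1) *\<^sub>C ((1/2) *\<^sub>R 1)) = h"
      unfolding scaleR_scaleC[symmetric] using r by simp
    finally show ?thesis .
  qed
  have "C A" for A
  proof -
    obtain h k where hk: "adj h = h" "adj k = k" "A = h + \<i> *\<^sub>C k"
      by (rule selfadj_decomposition)
    show ?thesis unfolding hk(3) by (intro C_add C_scale C_sa hk(1,2))
  qed
  then show ?thesis
    by (simp add: weakly_clustering_def cesaro_mean_two_point_iff C_def)
qed

end

theorem theorem4p1:
  fixes J :: "'j set"
    and a :: "'j \<Rightarrow> 'a::cstar_algebra"
    and \<phi> :: "'a \<Rightarrow>\<^sub>L complex"
  assumes "car_algebra J a"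
    and "infinite J"
    and "\<phi> \<in> symmetric_states J a"
  shows "blinfun_apply \<phi> \<circ> parity J a = blinfun_apply \<phi> \<and>
    asymptotically_abelian_in_average J a \<phi> \<and>
    (\<phi> extreme_point_of symmetric_states J a \<longleftrightarrow> weakly_clustering J a \<phi>)"
proof -
  interpret infinite_car_system J a
    using assms(1,2) by unfold_locales
  have "blinfun_apply \<phi> \<circ> parity J a = blinfun_apply \<phi>"
    using symmetric_state_even[OF assms(3)] by (simp add: fun_eq_iff)
  then show ?thesis
    using bounded_functional_asymptotically_abelian weakly_clustering_imp_extreme[OF assms(3)]
      extreme_imp_weakly_clustering by blast
qed

end
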